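(* Suppose $E:\mathcal{P}_{2,\omega_0}(\mathbb{R}^d)\to\mathbb{R}\cup\{+\infty\}$ is proper, coercive, lower semicontinuous and $\lambda$-convex along generalized geodesics for some $\lambda\in\mathbb{R}$, and let $\mu\in D(|\partial E|)$, $\nu\in\overline{D(E)}$. Then for all $0<\tau<\frac1{\lambda^-}$: if $\lambda>0$, $(1+\lambda\tau)^2W_2^2(J_\tau\mu,J_\tau\nu)\le W_2^2(\mu,\nu)+\tau^2|\partial E|^2(\mu)+2\lambda\tau^2[E(\nu)-\inf E]$; if $\lambda\le0$, $(1+\lambda\tau)^2W_2^2(J_\tau\mu,J_\tau\nu)\le W_2^2(\mu,\nu)+\tau^2|\partial E|^2(\mu)$.
   Context: Fix a probability measure $\omega_0$ on $\mathbb{R}^d$. $W_2$ is the quadratic Wasserstein distance, $\Gamma_0(\mu,\nu)$ the optimal couplings; $\mathcal{P}_{2,\omega_0}(\mathbb{R}^d)=\{\mu:W_2(\mu,\omega_0)<\infty\}$. A transport plan from $\mu_0$ to $\mu_1$ with base $\omega$ is $\boldsymbol\omega\in\mathcal{P}((\mathbb{R}^d)^3)$ with $\pi^{1,2}\#\boldsymbol\omega\in\Gamma_0(\omega,\mu_0)$, $\pi^{1,3}\#\boldsymbol\omega\in\Gamma_0(\omega,\mu_1)$; generalized geodesic $\mu_\alpha=((1-\alpha)\pi^2+\alpha\pi^3)\#\boldsymbol\omega$; $W_{2,\boldsymbol\omega}(\mu_0,\mu_1)=(\int|x_2-x_3|^2d\boldsymbol\omega)^{1/2}$. $D(E)=\{E<\infty\}$;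 proper: $D(E)\ne\emptyset$; coercive: $\exists\tau_0>0,u_0$ with $\inf_v\{\frac1{2\tau_0}W_2^2(u_0,v)+E(v)\}>-\infty$; lower semicontinuous w.r.t. $W_2$; $\lambda$-convex along generalized geodesics: for all $\mu_0,\mu_1,\omega$ there is a generalized geodesic from $\mu_0$ to $\mu_1$ with base $\omega$ (induced by some $\boldsymbol\omega$) with $E(\mu_\alpha)\le(1-\alpha)E(\mu_0)+\alpha E(\mu_1)-\alpha(1-\alpha)\frac\lambda2W^2_{2,\boldsymbol\omega}(\mu_0,\mu_1)$. $\lambda^-=\max\{0,-\lambda\}$, $1/\lambda^-=+\infty$ if $\lambda^-=0$; $\overline{D(E)}$ is the $W_2$-closure. $J_\tau\mu=\operatorname{argmin}_\nu\{\frac1{2\tau}W_2^2(\mu,\nu)+E(\nu)\}$ (well defined for $\mu\in\overline{D(E)}$, $0<\tau<1/\lambda^-$). Metric slope $|\partial E|(\mu)=\limsup_{\nu\to\mu}(E(\mu)-E(\nu))^+/W_2(\mu,\nu)$; $D(|\partial E|)=\{\mu\in D(E):|\partial E|(\mu)<\infty\}$. *)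

theory Defs
  imports "HOL-Probability.Probability"
begin

definition pmeas :: "'a::euclidean_space measure set" where
  "pmeas = {\<mu>. prob_space \<mu> \<and> sets \<mu> = sets borel}"

definition couplings :: "'a::euclidean_space measure \<Rightarrow> 'a measure \<Rightarrow> ('a \<times> 'a) measure set" where
  "couplings \<mu> \<nu> = {\<gamma>. prob_space \<gamma> \<and> sets \<gamma> = sets borel \<and>
       distr \<gamma> borel fst = \<mu> \<and> distr \<gamma> borel snd = \<nu>}"

definition cost2 :: "('a::euclidean_space \<times> 'a) measure \<Rightarrow> ennreal" where
  "cost2 \<gamma> = (\<integral>\<^sup>+ p. ennreal ((norm (fst p - snd p))\<^sup>2) \<partial>\<gamma>)"

definition W2sq :: "'a::euclidean_space measure \<Rightarrow> 'a measure \<Rightarrow> ennreal" where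
  "W2sq \<mu> \<nu> = (INF \<gamma>\<in>couplings \<mu> \<nu>. cost2 \<gamma>)"

text \<open>W_2 as a real number (finite on P_{2,omega0}).\<close>
definition W2 :: "'a::euclidean_space measure \<Rightarrow> 'a measure \<Rightarrow> real" where
  "W2 \<mu> \<nu> = sqrt (enn2real (W2sq \<mu> \<nu>))"

definition opt_couplings :: "'a::euclidean_space measure \<Rightarrow> 'a measure \<Rightarrow> ('a \<times> 'a) measure set" where
  "opt_couplings \<mu> \<nu> = {\<gamma>\<in>couplings \<mu> \<nu>. cost2 \<gamma> = W2sq \<mu> \<nu>}"

definition P2 :: "'a::euclidean_space measure \<Rightarrow> 'a measure set" where
  "P2 \<omega>0 = {\<mu>\<in>pmeas. W2sq \<mu> \<omega>0 < \<infinity>}"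

definition transport_plans ::
  "'a::euclidean_space measure \<Rightarrow> 'a measure \<Rightarrow> 'a measure \<Rightarrow> ('a \<times> 'a \<times> 'a) measure set" where
  "transport_plans \<omega> \<mu>0 \<mu>1 = {\<Omega>. prob_space \<Omega> \<and> sets \<Omega> = sets borel \<and>
      distr \<Omega> borel (\<lambda>(x1,x2,x3). (x1,x2)) \<in> opt_couplings \<omega> \<mu>0 \<and>
      distr \<Omega> borel (\<lambda>(x1,x2,x3). (x1,x3)) \<in> opt_couplings \<omega> \<mu>1}"

definition gen_geod :: "('a::euclidean_space \<times> 'a \<times> 'a) measure \<Rightarrow> real \<Rightarrow> 'a measure" where
  "gen_geod \<Omega> \<alpha> = distr \<Omega> borel (\<lambda>(x1,x2,x3). (1 - \<alpha>) *\<^sub>R x2 + \<alpha> *\<^sub>R x3)"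

definition W2_plan :: "('a::euclidean_space \<times> 'a \<times> 'a) measure \<Rightarrow> real" where
  "W2_plan \<Omega> = sqrt (enn2real (\<integral>\<^sup>+ p. ennreal ((norm (fst (snd p) - snd (snd p)))\<^sup>2) \<partial>\<Omega>))"

text \<open>Energy E : P_{2,omega0} -> R \<union> {+\<infinity>}, represented as an ereal-valued function
  that is only considered on P2 omega0 and never takes the value -\<infinity> there.\<close>

definition dom_E :: "'a::euclidean_space measure \<Rightarrow> ('a measure \<Rightarrow> ereal) \<Rightarrow> 'a measure set" where
  "dom_E \<omega>0 E = {\<mu>\<in>P2 \<omega>0. E \<mu> < \<infinity>}"

definition proper :: "'a::euclidean_space measure \<Rightarrow> ('a measure \<Rightarrow> ereal) \<Rightarrow> bool" where
  "proper \<omega>0 E \<longleftrightarrow> dom_E \<omega>0 E \<noteq> {}"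

definition coercive :: "'a::euclidean_space measure \<Rightarrow> ('a measure \<Rightarrow> ereal) \<Rightarrow> bool" where
  "coercive \<omega>0 E \<longleftrightarrow> (\<exists>\<tau>0>0. \<exists>u0\<in>P2 \<omega>0.
      (INF v\<in>P2 \<omega>0. ereal ((W2 u0 v)\<^sup>2 / (2 * \<tau>0)) + E v) > -\<infinity>)"

definition W2_lsc :: "'a::euclidean_space measure \<Rightarrow> ('a measure \<Rightarrow> ereal) \<Rightarrow> bool" where
  "W2_lsc \<omega>0 E \<longleftrightarrow> (\<forall>\<mu>s \<mu>. (\<forall>n. \<mu>s n \<in> P2 \<omega>0) \<longrightarrow> \<mu> \<in> P2 \<omega>0 \<longrightarrow>
      (\<lambda>n. W2 (\<mu>s n) \<mu>) \<longlonglongrightarrow> 0 \<longrightarrow> E \<mu> \<le> liminf (\<lambda>n. E (\<mu>s n)))"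

definition gg_convex :: "'a::euclidean_space measure \<Rightarrow> ('a measure \<Rightarrow> ereal) \<Rightarrow> real \<Rightarrow> bool" where
  "gg_convex \<omega>0 E lam \<longleftrightarrow> (\<forall>\<mu>0\<in>P2 \<omega>0. \<forall>\<mu>1\<in>P2 \<omega>0. \<forall>\<omega>\<in>P2 \<omega>0.
      \<exists>\<Omega>\<in>transport_plans \<omega> \<mu>0 \<mu>1. \<forall>\<alpha>\<in>{0..1}.
        E (gen_geod \<Omega> \<alpha>) \<le> ereal (1 - \<alpha>) * E \<mu>0 + ereal \<alpha> * E \<mu>1
                              - ereal (\<alpha> * (1 - \<alpha>) * (lam / 2) * (W2_plan \<Omega>)\<^sup>2))"

definition cl_dom_E :: "'a::euclidean_space measure \<Rightarrow> ('a measure \<Rightarrow> ereal) \<Rightarrow> 'a measure set" where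
  "cl_dom_E \<omega>0 E = {\<mu>\<in>P2 \<omega>0. \<forall>\<epsilon>>0. \<exists>\<nu>\<in>dom_E \<omega>0 E. W2 \<mu> \<nu> < \<epsilon>}"

text \<open>Proximal map J_tau: the (unique, when well defined) minimizer.\<close>
definition prox :: "'a::euclidean_space measure \<Rightarrow> ('a measure \<Rightarrow> ereal) \<Rightarrow> real \<Rightarrow> 'a measure \<Rightarrow> 'a measure" where
  "prox \<omega>0 E \<tau> \<mu> = (SOME \<nu>. \<nu> \<in> P2 \<omega>0 \<and> (\<forall>\<rho>\<in>P2 \<omega>0.
      ereal ((W2 \<mu> \<nu>)\<^sup>2 / (2 * \<tau>)) + E \<nu> \<le> ereal ((W2 \<mu> \<rho>)\<^sup>2 / (2 * \<tau>)) + E \<rho>))"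

definition slope :: "'a::euclidean_space measure \<Rightarrow> ('a measure \<Rightarrow> ereal) \<Rightarrow> 'a measure \<Rightarrow> ereal" where
  "slope \<omega>0 E \<mu> = (INF \<delta>\<in>{0::real<..}.
      SUP \<nu>\<in>{\<nu>\<in>P2 \<omega>0. 0 < W2 \<mu> \<nu> \<and> W2 \<mu> \<nu> < \<delta>}.
        max 0 ((E \<mu> - E \<nu>) / ereal (W2 \<mu> \<nu>)))"

definition dom_slope :: "'a::euclidean_space measure \<Rightarrow> ('a measure \<Rightarrow> ereal) \<Rightarrow> 'a measure set" where
  "dom_slope \<omega>0 E = {\<mu>\<in>dom_E \<omega>0 E. slope \<omega>0 E \<mu> < \<infinity>}"

definition lam_minus_inv_bound :: "real \<Rightarrow> ereal" where
  "lam_minus_inv_bound lam = (if lam \<ge> 0 then \<infinity> else ereal (1 / (- lam)))"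

end

theory Submission
  imports Defs
begin

text \<open>
  The distance \<open>W2\<close> is a complete pseudometric on \<open>P2 \<omega>0\<close>. The triangle inequality and
  completeness are usually derived by gluing couplings along a common marginal, which needs
  disintegration; here couplings are only glued up to a small error, along a fine countable
  partition of the common marginal space.

  The objective \<open>W2 \<mu> v ^ 2 / (2 * \<tau>) + E v\<close> is \<open>(1 / \<tau> + lam)\<close>-convex along generalized geodesics
  with base \<open>\<mu>\<close>, hence it is bounded below and its minimizing sequences are Cauchy, so that
  \<open>J \<mu>\<close> exists. Comparing \<open>J \<mu>\<close> with nearby points of the geodesic from \<open>J \<mu>\<close> to \<open>v\<close> gives the
  discrete variational inequality
  \<open>(1 + lam * \<tau>) * W2 (J \<mu>) v ^ 2 \<le> W2 \<mu> v ^ 2 + 2 * \<tau> * (E v - E (J \<mu>)) - W2 \<mu> (J \<mu>) ^ 2\<close>.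
  It is used for \<open>\<mu>\<close> with \<open>v = J \<nu>\<close> and for \<open>\<nu>\<close> with \<open>v = \<mu>\<close>, while convexity along the geodesic
  from \<open>\<mu>\<close> to \<open>J \<mu>\<close> bounds \<open>E \<mu> - E (J \<mu>)\<close> by the slope.
\<close>

section \<open>Gluing couplings up to small errors\<close>

lemma borel_measurable_fst [measurable]:
  "(fst :: 'a::topological_space \<times> 'b::topological_space \<Rightarrow> 'a) \<in> borel_measurable borel"
  by (intro borel_measurable_continuous_onI continuous_on_fst continuous_on_id)

lemma borel_measurable_snd [measurable]:
  "(snd :: 'a::topological_space \<times> 'b::topological_space \<Rightarrow> 'b) \<in> borel_measurable borel"
  by (intro borel_measurable_continuous_onI continuous_on_snd continuous_on_id)

text \<open>The cell of \<open>x\<close> is the index of the first point of a countable dense set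
  within \<open>e / 2\<close> of \<open>x\<close>; taking the first one makes the cells disjoint and
  measurable.\<close>

lemma countable_fine_partition:
  fixes e :: real
  assumes "e > 0"
  obtains c :: "'a::{metric_space, second_countable_topology} \<Rightarrow> nat"
  where "c \<in> borel \<rightarrow>\<^sub>M count_space UNIV" "\<And>x y. c x = c y \<Longrightarrow> dist x y \<le> e"
proof -
  obtain D :: "'a set" where D: "countable D" "\<And>X. open X \<Longrightarrow> X \<noteq> {} \<Longrightarrow> \<exists>d\<in>D. d \<in> X"
    by (rule countable_dense_setE) blast
  define d where "d = from_nat_into D"
  have ex: "\<exists>i. dist x (d i) < e / 2" for x
  proof -
    obtain y where "y \<in> D" "y \<in> ball x (e / 2)"
      using D(2)[of "ball x (e / 2)"] assms by auto
    then show ?thesis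
      using from_nat_into_surj[OF D(1)] unfolding d_def by (metis mem_ball)
  qed
  define c where "c x = (LEAST i. dist x (d i) < e / 2)" for x
  have c: "dist x (d (c x)) < e / 2" for x
    unfolding c_def by (rule LeastI_ex[OF ex])
  show ?thesis
  proof
    show "c \<in> borel \<rightarrow>\<^sub>M count_space UNIV"
      unfolding c_def by measurable
    show "dist x y \<le> e" if "c x = c y" for x y
      using c[of x] c[of y] that dist_triangle2[of x y "d (c x)"] by simp
  qed
qed

text \<open>The joint law of all coordinates is the product measure itself, hence the product of the
  coordinate laws.\<close>

lemma PiM_indep_vars:
  assumes "\<And>i. prob_space (G i)" and "I \<noteq> {}"
  shows "prob_space.indep_vars (PiM I G) G (\<lambda>i x. x i) I"
proof -
  interpret product_prob_space G I
    using assms by (intro product_prob_spaceI) auto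
  interpret prob_space "PiM I G" by (rule P.prob_space_axioms)
  have "distr (PiM I G) (PiM I G) (\<lambda>x. \<lambda>i\<in>I. x i) = distr (PiM I G) (PiM I G) (\<lambda>x. x)"
    by (intro distr_cong) (auto simp: space_PiM fun_eq_iff PiE_def extensional_def)
  also have "\<dots> = PiM I G"
    by (rule distr_id2) simp
  also have "\<dots> = (\<Pi>\<^sub>M i\<in>I. distr (PiM I G) (G i) (\<lambda>x. x i))"
    by (intro PiM_cong) (auto simp: PiM_component)
  finally show ?thesis
    using assms by (subst indep_vars_iff_distr_eq_PiM') auto
qed

text \<open>Exact gluing of couplings needs disintegration. Gluing along a countable partition of
  the middle space into cells of diameter at most \<open>e n\<close> does not: conditioned on the cell, the
  next coupling is drawn independently of the past.\<close>

lemma coupling_chain: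
  fixes \<gamma> :: "nat \<Rightarrow> ('a::euclidean_space \<times> 'a) measure"
  assumes \<gamma>: "\<And>n. \<gamma> n \<in> couplings (z n) (z (Suc n))" and e: "\<And>n. e n > (0::real)"
  obtains M :: "(nat \<times> nat \<Rightarrow> 'a \<times> 'a) measure" and Y where
    "prob_space M" "\<And>n. Y n \<in> borel_measurable M" "\<And>n. distr M borel (Y n) = \<gamma> n"
    "\<And>n. AE x in M. dist (snd (Y n x)) (fst (Y (Suc n) x)) \<le> e n"
proof -
  have "\<forall>n. \<exists>c :: 'a \<Rightarrow> nat. c \<in> borel \<rightarrow>\<^sub>M count_space UNIV \<and> (\<forall>x y. c x = c y \<longrightarrow> dist x y \<le> e n)"
    using countable_fine_partition[OF e] by metis
  then obtain c :: "nat \<Rightarrow> 'a \<Rightarrow> nat" where c[measurable]: "\<And>n. c n \<in> borel \<rightarrow>\<^sub>M count_space UNIV"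
    and c_fine: "\<And>n x y. c n x = c n y \<Longrightarrow> dist x y \<le> e n"
    by metis
  have prob\<gamma>: "prob_space (\<gamma> n)" and sets\<gamma>[measurable_cong]: "sets (\<gamma> n) = sets borel"
    and fst\<gamma>: "distr (\<gamma> n) borel fst = z n" and snd\<gamma>: "distr (\<gamma> n) borel snd = z (Suc n)" for n
    using \<gamma>[of n] by (auto simp: couplings_def)
  have sp\<gamma>[simp]: "space (\<gamma> n) = UNIV" for n
    using sets_eq_imp_space_eq[OF sets\<gamma>[of n]] by simp
  have fin\<gamma>: "emeasure (\<gamma> n) A \<noteq> \<top>" for n A
    using finite_measure.emeasure_finite[OF prob_space.finite_measure[OF prob\<gamma>]] .
  define Q where "Q n i = {p :: 'a \<times> 'a. c n (fst p) = i}" for n i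
  have Q[measurable]: "Q n i \<in> sets borel" for n i
  proof -
    have "{p \<in> space borel. c n (fst p) = i} \<in> sets borel" by measurable
    then show ?thesis by (simp add: Q_def)
  qed
  have cs[measurable]: "{y. c n y = i} \<in> sets borel" "{p. c n (snd p) = i} \<in> sets borel" for n i
    using measurable_sets[of "c n" borel "count_space UNIV" "{i}"]
      measurable_sets[of "\<lambda>p. c n (snd p)" borel "count_space UNIV" "{i}"]
    by (simp_all add: vimage_def)
  \<comment> \<open>\<open>G (Suc m, i)\<close> is the coupling \<open>\<gamma> (Suc m)\<close>
    conditioned on its first component lying in cell \<open>i\<close> of the partition
    \<open>c m\<close>. On a null cell the unconditioned coupling is a default that is almost surely
    never selected.\<close>
  define G where "G = (\<lambda>(n, i). case n of 0 \<Rightarrow> \<gamma> 0 | Suc m \<Rightarrow>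
      if emeasure (\<gamma> n) (Q m i) = 0 then \<gamma> n else uniform_measure (\<gamma> n) (Q m i))"
  have setsG[measurable_cong]: "sets (G j) = sets borel" for j
    by (cases j) (auto simp: G_def sets\<gamma> split: nat.split)
  have probG: "prob_space (G j)" for j
    using prob\<gamma> fin\<gamma> by (cases j) (auto simp: G_def split: nat.split intro!: prob_space_uniform_measure)
  \<comment> \<open>The multiplied-out form of conditional probability also covers null cells, where
    both sides vanish.\<close>
  have G_cond: "emeasure (\<gamma> (Suc n)) (Q n i) * emeasure (G (Suc n, i)) A = emeasure (\<gamma> (Suc n)) (Q n i \<inter> A)"
    if A: "A \<in> sets borel" for n i A
  proof (cases "emeasure (\<gamma> (Suc n)) (Q n i) = 0")
    case True
    then have "emeasure (\<gamma> (Suc n)) (Q n i \<inter> A) \<le> 0"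
      using Q[of n i] A by (metis emeasure_mono inf_le1 sets\<gamma>)
    with True show ?thesis by simp
  next
    case False
    show ?thesis
      using False A fin\<gamma> Q[of n i]
      by (simp add: G_def emeasure_uniform_measure sets\<gamma> ennreal_times_divide)
        (subst mult.commute, simp add: mult_divide_eq_ennreal)
  qed
  define M where "M = PiM UNIV G"
  have setsM[measurable_cong]: "sets M = sets (PiM UNIV (\<lambda>_. borel))"
    unfolding M_def by (intro sets_PiM_cong) (auto simp: setsG)
  interpret product_prob_space G UNIV
    using probG by (intro product_prob_spaceI) auto
  interpret prob_space M unfolding M_def by (rule P.prob_space_axioms)
  \<comment> \<open>All conditional draws, one for each time and cell, are made independently in
    advance. The path reads at time \<open>Suc n\<close> the draw belonging to the cell of the
    second component of \<open>Y n\<close>.\<close>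
  define Y where "Y = rec_nat (\<lambda>x :: nat \<times> nat \<Rightarrow> 'a \<times> 'a. x (0, 0))
      (\<lambda>n f x. x (Suc n, c n (snd (f x))))"
  have Y_0: "Y 0 x = x (0, 0)" and Y_Suc: "Y (Suc n) x = x (Suc n, c n (snd (Y n x)))" for n x
    by (simp_all add: Y_def)
  \<comment> \<open>\<open>Y n\<close> reads only coordinates of time at most \<open>n\<close>; this
    gives its independence of the draws at time \<open>Suc n\<close>.\<close>
  have Y_cong: "Y n x = Y n y" if "\<And>j. j \<in> {..n} \<times> UNIV \<Longrightarrow> x j = y j" for n x y
    using that by (induction n) (auto simp: Y_0 Y_Suc)
  have Y_restrict: "Y n (restrict x ({..n} \<times> UNIV)) = Y n x" for n x
    by (rule Y_cong) auto
  have Y_meas: "Y n \<in> PiM ({..n} \<times> UNIV) (\<lambda>_. borel) \<rightarrow>\<^sub>M borel" for n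
  proof (induction n)
    case 0
    show ?case unfolding Y_0[abs_def] by measurable
  next
    case (Suc n)
    have "(\<lambda>x. Y n (restrict x ({..n} \<times> UNIV))) \<in> PiM ({..Suc n} \<times> UNIV) (\<lambda>_. borel) \<rightarrow>\<^sub>M borel"
      by (rule measurable_compose[OF measurable_restrict_subset Suc]) auto
    then have [measurable]: "Y n \<in> PiM ({..Suc n} \<times> UNIV) (\<lambda>_. borel) \<rightarrow>\<^sub>M borel"
      by (simp add: Y_restrict)
    have "(\<lambda>x. x (Suc n, c n (snd (Y n x)))) \<in> PiM ({..Suc n} \<times> UNIV) (\<lambda>_. borel) \<rightarrow>\<^sub>M borel"
      by (rule measurable_compose_countable[where f="\<lambda>i x. x (Suc n, i)"]) measurable
    then show ?case unfolding Y_Suc[abs_def] .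
  qed
  have YM[measurable]: "Y n \<in> borel_measurable M" for n
  proof -
    have "(\<lambda>x. Y n (restrict x ({..n} \<times> UNIV))) \<in> PiM UNIV (\<lambda>_. borel) \<rightarrow>\<^sub>M borel"
      by (rule measurable_compose[OF measurable_restrict_subset Y_meas]) auto
    then show ?thesis
      by (simp add: Y_restrict measurable_cong_sets[OF setsM refl])
  qed
  have indep: "indep_vars G (\<lambda>i x. x i) UNIV"
    unfolding M_def by (rule PiM_indep_vars[OF probG]) simp
  \<comment> \<open>Independence splits the probability into the mass of the cell under the common
    marginal \<open>z (Suc n)\<close> and the conditional law; \<open>G_cond\<close> recombines the
    two.\<close>
  have step: "emeasure M {x \<in> space M. c n (snd (Y n x)) = i \<and> x (Suc n, i) \<in> A}
      = emeasure (\<gamma> (Suc n)) (Q n i \<inter> A)"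
    if law: "distr M borel (Y n) = \<gamma> n" and A[measurable]: "A \<in> sets borel" for n i A
  proof -
    let ?K = "{..n} \<times> (UNIV :: nat set)" and ?j = "(Suc n, i)"
    have cY: "(\<lambda>x. c n (snd (Y n x)) = i) \<in> PiM ?K G \<rightarrow>\<^sub>M count_space UNIV"
      using Y_meas[of n] unfolding measurable_cong_sets[OF sets_PiM_cong[OF refl setsG] refl]
      by measurable
    have cA: "(\<lambda>x. x ?j \<in> A) \<in> PiM {?j} G \<rightarrow>\<^sub>M count_space UNIV"
      unfolding measurable_cong_sets[OF sets_PiM_cong[OF refl setsG] refl] by measurable
    have "indep_var (count_space UNIV) ((\<lambda>x. c n (snd (Y n x)) = i) \<circ> (\<lambda>x. restrict x ?K))
        (count_space UNIV) ((\<lambda>x. x ?j \<in> A) \<circ> (\<lambda>x. restrict x {?j}))"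
      by (rule indep_var_compose[OF indep_var_restrict[OF indep] cY cA]) auto
    from indep_varD[OF this, of "{True}" "{True}"]
    have "prob {x \<in> space M. c n (snd (Y n x)) = i \<and> x ?j \<in> A}
        = prob {x \<in> space M. c n (snd (Y n x)) = i} * prob {x \<in> space M. x ?j \<in> A}"
      by (simp add: setsG vimage_def Int_def conj_commute Y_restrict)
    then have "emeasure M {x \<in> space M. c n (snd (Y n x)) = i \<and> x ?j \<in> A}
        = emeasure M {x \<in> space M. c n (snd (Y n x)) = i} * emeasure M {x \<in> space M. x ?j \<in> A}"
      by (simp add: emeasure_eq_measure ennreal_mult)
    also have "emeasure M {x \<in> space M. x ?j \<in> A} = emeasure (distr M (G ?j) (\<lambda>x. x ?j)) A"
      by (subst emeasure_distr) (auto simp: setsG vimage_def Int_def conj_commute)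
    also have "distr M (G ?j) (\<lambda>x. x ?j) = G ?j"
      unfolding M_def by (rule PiM_component) simp
    also have "emeasure M {x \<in> space M. c n (snd (Y n x)) = i}
        = emeasure (distr M borel (Y n)) {p. c n (snd p) = i}"
      by (subst emeasure_distr) (auto simp: vimage_def Int_def conj_commute)
    also have "\<dots> = emeasure (distr (\<gamma> n) borel snd) {y. c n y = i}"
      by (subst emeasure_distr) (auto simp: law vimage_def)
    also have "\<dots> = emeasure (distr (\<gamma> (Suc n)) borel fst) {y. c n y = i}"
      by (simp add: snd\<gamma> fst\<gamma>)
    also have "\<dots> = emeasure (\<gamma> (Suc n)) (Q n i)"
      by (subst emeasure_distr) (auto simp: Q_def vimage_def)
    finally show ?thesis
      by (simp add: G_cond)
  qed
  have law: "distr M borel (Y n) = \<gamma> n" for n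
  proof (induction n)
    case 0
    have "distr M borel (Y 0) = distr M (G (0, 0)) (\<lambda>x. x (0, 0))"
      by (intro distr_cong) (auto simp: setsG Y_0)
    also have "\<dots> = G (0, 0)"
      unfolding M_def by (rule PiM_component) simp
    finally show ?case by (simp add: G_def)
  next
    case (Suc n)
    show ?case
    proof (rule measure_eqI)
      fix A assume "A \<in> sets (distr M borel (Y (Suc n)))"
      then have A[measurable]: "A \<in> sets borel" by simp
      have "emeasure (distr M borel (Y (Suc n))) A = emeasure M {x \<in> space M. Y (Suc n) x \<in> A}"
        by (subst emeasure_distr) (auto simp: vimage_def Int_def conj_commute)
      also have "{x \<in> space M. Y (Suc n) x \<in> A}
          = (\<Union>i. {x \<in> space M. c n (snd (Y n x)) = i \<and> x (Suc n, i) \<in> A})"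
        by (auto simp: Y_Suc)
      also have "emeasure M \<dots> = (\<Sum>i. emeasure M {x \<in> space M. c n (snd (Y n x)) = i \<and> x (Suc n, i) \<in> A})"
        by (rule suminf_emeasure[symmetric]) (auto simp: disjoint_family_on_def)
      also have "\<dots> = (\<Sum>i. emeasure (\<gamma> (Suc n)) (Q n i \<inter> A))"
        using Suc by (simp add: step)
      also have "\<dots> = emeasure (\<gamma> (Suc n)) (\<Union>i. Q n i \<inter> A)"
        by (rule suminf_emeasure) (auto simp: disjoint_family_on_def Q_def[of n] sets\<gamma>)
      also have "(\<Union>i. Q n i \<inter> A) = A"
        by (auto simp: Q_def)
      finally show "emeasure (distr M borel (Y (Suc n))) A = emeasure (\<gamma> (Suc n)) A" .
    qed (simp add: sets\<gamma>)
  qed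
  have close: "AE x in M. dist (snd (Y n x)) (fst (Y (Suc n) x)) \<le> e n" for n
  proof -
    \<comment> \<open>By \<open>step\<close> with the complement of \<open>Q n i\<close>, a selected
      draw misses its cell with probability 0, and there are countably many cells.\<close>
    have "AE x in M. \<forall>i. \<not> (c n (snd (Y n x)) = i \<and> x (Suc n, i) \<in> - Q n i)"
    proof (subst AE_all_countable, rule allI)
      fix i
      have "{x \<in> space M. c n (snd (Y n x)) = i \<and> x (Suc n, i) \<in> - Q n i} \<in> null_sets M"
        using step[OF law, of "- Q n i" n i] by (intro null_setsI) auto
      then show "AE x in M. \<not> (c n (snd (Y n x)) = i \<and> x (Suc n, i) \<in> - Q n i)"
        by (rule AE_I') auto
    qed
    then show ?thesis
      by eventually_elim (auto intro: c_fine simp: Q_def Y_Suc)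
  qed
  show ?thesis
    by (rule that[OF prob_space_axioms YM law close])
qed

section \<open>The Wasserstein distance\<close>

text \<open>Letting \<open>d\<close> tend to 0 removes the slack left by near-optimal couplings and
  approximate gluing.\<close>

lemma ennreal_le_sq_limit:
  fixes X :: ennreal
  assumes "\<And>d. d > 0 \<Longrightarrow> X \<le> ennreal ((P + k * d)\<^sup>2)"
  shows "X \<le> ennreal (P\<^sup>2)"
proof (rule tendsto_lowerbound)
  show "((\<lambda>d. ennreal ((P + k * d)\<^sup>2)) \<longlongrightarrow> ennreal (P\<^sup>2)) (at_right 0)"
    by (intro tendsto_ennrealI) (auto intro!: tendsto_eq_intros)
  show "\<forall>\<^sub>F d in at_right 0. X \<le> ennreal ((P + k * d)\<^sup>2)"
    using assms by (auto simp: eventually_at_filter)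
qed simp

text \<open>The weights make the right side exactly \<open>(P + Q)\<^sup>2\<close> at
  \<open>a = P\<close>, \<open>b = Q\<close>, and the deficit is a square divided by
  \<open>P * Q\<close>.\<close>

lemma sq_add_le_weighted:
  fixes a b P Q :: real
  assumes "P > 0" "Q > 0"
  shows "(a + b)\<^sup>2 \<le> (1 + Q / P) * a\<^sup>2 + (1 + P / Q) * b\<^sup>2"
proof -
  have "(1 + Q / P) * a\<^sup>2 + (1 + P / Q) * b\<^sup>2 - (a + b)\<^sup>2 = (Q * a - P * b)\<^sup>2 / (P * Q)"
    using assms by (simp add: field_simps power2_eq_square)
  moreover have "\<dots> \<ge> 0" using assms by simp
  ultimately show ?thesis by linarith
qed

text \<open>Minkowski's inequality in L2: the weighted inequality is integrated pointwise, with
  weights taken from the bounds on the two norms.\<close>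

lemma nn_integral_L2_triangle:
  fixes f g h :: "'b \<Rightarrow> real"
  assumes [measurable]: "g \<in> borel_measurable M" "h \<in> borel_measurable M"
    and f: "AE x in M. \<bar>f x\<bar> \<le> g x + h x"
    and g: "(\<integral>\<^sup>+ x. ennreal ((g x)\<^sup>2) \<partial>M) \<le> ennreal (P\<^sup>2)"
    and h: "(\<integral>\<^sup>+ x. ennreal ((h x)\<^sup>2) \<partial>M) \<le> ennreal (Q\<^sup>2)"
    and PQ: "0 \<le> P" "0 \<le> Q"
  shows "(\<integral>\<^sup>+ x. ennreal ((f x)\<^sup>2) \<partial>M) \<le> ennreal ((P + Q)\<^sup>2)"
proof (rule ennreal_le_sq_limit[where k=2])
  fix d :: real assume d: "d > 0"
  \<comment> \<open>\<open>P\<close> and \<open>Q\<close> may vanish, so both are enlarged by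
    \<open>d\<close> to make the weights defined; this costs \<open>2 * d\<close> in the
    end.\<close>
  define P' where "P' = P + d"
  define Q' where "Q' = Q + d"
  have pos: "P' > 0" "Q' > 0" using PQ d by (auto simp: P'_def Q'_def)
  have "(\<integral>\<^sup>+ x. ennreal ((f x)\<^sup>2) \<partial>M)
      \<le> (\<integral>\<^sup>+ x. ennreal (1 + Q' / P') * ennreal ((g x)\<^sup>2) + ennreal (1 + P' / Q') * ennreal ((h x)\<^sup>2) \<partial>M)"
  proof (rule nn_integral_mono_AE)
    show "AE x in M. ennreal ((f x)\<^sup>2)
        \<le> ennreal (1 + Q' / P') * ennreal ((g x)\<^sup>2) + ennreal (1 + P' / Q') * ennreal ((h x)\<^sup>2)"
      using f
    proof eventually_elim
      case (elim x)
      have "(f x)\<^sup>2 \<le> (g x + h x)\<^sup>2"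
        using elim by (simp add: abs_le_square_iff[symmetric])
      also note sq_add_le_weighted[OF pos]
      finally show ?case
        using pos by (simp flip: ennreal_mult ennreal_plus)
    qed
  qed
  also have "\<dots> = ennreal (1 + Q' / P') * (\<integral>\<^sup>+ x. ennreal ((g x)\<^sup>2) \<partial>M)
      + ennreal (1 + P' / Q') * (\<integral>\<^sup>+ x. ennreal ((h x)\<^sup>2) \<partial>M)"
    by (simp add: nn_integral_add nn_integral_cmult)
  also have "\<dots> \<le> ennreal (1 + Q' / P') * ennreal (P'\<^sup>2) + ennreal (1 + P' / Q') * ennreal (Q'\<^sup>2)"
    using PQ d by (intro add_mono mult_left_mono order_trans[OF g] order_trans[OF h] ennreal_leI power_mono)
      (auto simp: P'_def Q'_def)
  also have "\<dots> = ennreal ((1 + Q' / P') * P'\<^sup>2 + (1 + P' / Q') * Q'\<^sup>2)"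
    using pos by (simp flip: ennreal_mult ennreal_plus)
  also have "(1 + Q' / P') * P'\<^sup>2 + (1 + P' / Q') * Q'\<^sup>2 = (P + Q + 2 * d)\<^sup>2"
  proof -
    have "(1 + Q' / P') * P'\<^sup>2 + (1 + P' / Q') * Q'\<^sup>2 = (P' + Q')\<^sup>2"
      using pos by (simp add: field_simps power2_eq_square)
    then show ?thesis by (simp add: P'_def Q'_def algebra_simps)
  qed
  finally show "(\<integral>\<^sup>+ x. ennreal ((f x)\<^sup>2) \<partial>M) \<le> ennreal ((P + Q + 2 * d)\<^sup>2)" .
qed

lemma coupling_pmeas:
  assumes "\<gamma> \<in> couplings \<mu> \<nu>"
  shows "\<mu> \<in> pmeas" "\<nu> \<in> pmeas"
proof -
  interpret prob_space \<gamma> using assms by (simp add: couplings_def)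
  have s[measurable_cong]: "sets \<gamma> = sets borel" and m: "distr \<gamma> borel fst = \<mu>" "distr \<gamma> borel snd = \<nu>"
    using assms by (auto simp: couplings_def)
  show "\<mu> \<in> pmeas" "\<nu> \<in> pmeas"
    unfolding m[symmetric] pmeas_def by (auto intro!: prob_space_distr)
qed

text \<open>The joint law of \<open>X\<close> and \<open>Y\<close> is a coupling. Upper bounds on
  the distance arise below by realizing both measures on one probability space.\<close>

lemma W2sq_distr_le:
  fixes X Y :: "'b \<Rightarrow> 'a::euclidean_space"
  assumes "prob_space M" and [measurable]: "X \<in> borel_measurable M" "Y \<in> borel_measurable M"
  shows "W2sq (distr M borel X) (distr M borel Y) \<le> (\<integral>\<^sup>+ x. ennreal ((norm (X x - Y x))\<^sup>2) \<partial>M)"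
proof -
  interpret prob_space M by fact
  let ?\<gamma> = "distr M borel (\<lambda>x. (X x, Y x))"
  have "?\<gamma> \<in> couplings (distr M borel X) (distr M borel Y)"
    unfolding couplings_def by (auto intro!: prob_space_distr simp: distr_distr comp_def)
  then have "W2sq (distr M borel X) (distr M borel Y) \<le> cost2 ?\<gamma>"
    unfolding W2sq_def by (rule INF_lower)
  also have "\<dots> = (\<integral>\<^sup>+ x. ennreal ((norm (X x - Y x))\<^sup>2) \<partial>M)"
    unfolding cost2_def by (subst nn_integral_distr) auto
  finally show ?thesis .
qed

lemma W2sq_commute: "W2sq \<mu> \<nu> = W2sq \<nu> \<mu>"
proof -
  have "W2sq \<nu> \<mu> \<le> cost2 \<gamma>" if \<gamma>: "\<gamma> \<in> couplings \<mu> \<nu>" for \<mu> \<nu> :: "'a measure" and \<gamma>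
  proof -
    have [measurable_cong]: "sets \<gamma> = sets borel" using \<gamma> by (simp add: couplings_def)
    have "W2sq (distr \<gamma> borel snd) (distr \<gamma> borel fst) \<le> (\<integral>\<^sup>+ p. ennreal ((norm (snd p - fst p))\<^sup>2) \<partial>\<gamma>)"
      using \<gamma> by (intro W2sq_distr_le) (auto simp: couplings_def)
    then show ?thesis
      using \<gamma> by (simp add: couplings_def cost2_def norm_minus_commute)
  qed
  then have "W2sq \<nu> \<mu> \<le> W2sq \<mu> \<nu>" for \<mu> \<nu> :: "'a measure"
    unfolding W2sq_def[of \<mu>] by (intro INF_greatest)
  then show ?thesis by (intro antisym)
qed

lemma W2_commute: "W2 \<mu> \<nu> = W2 \<nu> \<mu>"
  by (simp add: W2_def W2sq_commute)

lemma W2_nonneg [simp]: "0 \<le> W2 \<mu> \<nu>"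
  by (simp add: W2_def)

lemma W2sq_self:
  assumes "\<mu> \<in> pmeas"
  shows "W2sq \<mu> \<mu> = 0"
proof -
  have s[measurable_cong]: "sets \<mu> = sets borel" and p: "prob_space \<mu>"
    using assms by (auto simp: pmeas_def)
  have "distr \<mu> borel (\<lambda>x. x) = \<mu>"
    by (rule distr_id2) (simp add: s)
  then show ?thesis
    using W2sq_distr_le[OF p, of "\<lambda>x. x" "\<lambda>x. x"] by simp
qed

text \<open>\<open>enn2real\<close> sends \<infinity> to 0, so \<open>W2\<close> carries the
  distance only where \<open>W2sq\<close> is finite.\<close>

lemma W2sq_eq_W2:
  assumes "W2sq \<mu> \<nu> < \<infinity>"
  shows "W2sq \<mu> \<nu> = ennreal ((W2 \<mu> \<nu>)\<^sup>2)"
  using assms by (simp add: W2_def)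

lemma W2_leI:
  assumes "W2sq \<mu> \<nu> \<le> ennreal (r\<^sup>2)" "0 \<le> r"
  shows "W2 \<mu> \<nu> \<le> r"
  using assms enn2real_mono[OF assms(1)] unfolding W2_def
  by (intro real_le_lsqrt) auto

lemma near_optimal_coupling:
  assumes "W2sq \<mu> \<nu> < \<infinity>" "d > 0"
  obtains \<gamma> where "\<gamma> \<in> couplings \<mu> \<nu>" "cost2 \<gamma> \<le> ennreal ((W2 \<mu> \<nu> + d)\<^sup>2)"
proof -
  have "(W2 \<mu> \<nu>)\<^sup>2 < (W2 \<mu> \<nu> + d)\<^sup>2"
    using assms by (intro power_strict_mono) auto
  then have "W2sq \<mu> \<nu> < ennreal ((W2 \<mu> \<nu> + d)\<^sup>2)"
    unfolding W2sq_eq_W2[OF assms(1)] by (simp add: ennreal_less_iff)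
  then show ?thesis
    using that unfolding W2sq_def INF_less_iff by (auto intro: less_imp_le)
qed

lemma W2sq_triangle:
  fixes a b c :: "'a::euclidean_space measure"
  assumes ab: "W2sq a b < \<infinity>" and bc: "W2sq b c < \<infinity>"
  shows "W2sq a c \<le> ennreal ((W2 a b + W2 b c)\<^sup>2)"
\<comment> \<open>One \<open>d\<close> comes from each near-optimal coupling and one from the gap
  where they are glued at \<open>b\<close>.\<close>
proof (rule ennreal_le_sq_limit[where k=3])
  fix d :: real assume d: "d > 0"
  obtain \<gamma>1 where \<gamma>1: "\<gamma>1 \<in> couplings a b" "cost2 \<gamma>1 \<le> ennreal ((W2 a b + d)\<^sup>2)"
    by (rule near_optimal_coupling[OF ab d])
  obtain \<gamma>2 where \<gamma>2: "\<gamma>2 \<in> couplings b c" "cost2 \<gamma>2 \<le> ennreal ((W2 b c + d)\<^sup>2)"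
    by (rule near_optimal_coupling[OF bc d])
  have c[measurable_cong]: "sets c = sets borel" and pc: "prob_space c"
    using coupling_pmeas[OF \<gamma>2(1)] by (auto simp: pmeas_def)
  have diag: "distr c borel (\<lambda>x. (x, x)) \<in> couplings c c"
    unfolding couplings_def using prob_space.prob_space_distr[OF pc, of "\<lambda>x. (x, x)" borel]
    by (auto simp: distr_distr comp_def c intro!: distr_id2)
  \<comment> \<open>Only the first two couplings matter; the diagonal coupling of \<open>c\<close>
    prolongs them to the infinite chain that \<open>coupling_chain\<close> takes.\<close>
  define z where "z n = (if n = 0 then a else if n = 1 then b else c)" for n :: nat
  define \<gamma> where "\<gamma> n = (if n = 0 then \<gamma>1 else if n = 1 then \<gamma>2 else distr c borel (\<lambda>x. (x, x)))" for n :: nat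
  have "\<gamma> n \<in> couplings (z n) (z (Suc n))" for n
    using \<gamma>1(1) \<gamma>2(1) diag by (auto simp: z_def \<gamma>_def)
  then obtain M :: "(nat \<times> nat \<Rightarrow> 'a \<times> 'a) measure" and Y where M: "prob_space M"
    and Y[measurable]: "\<And>n. Y n \<in> borel_measurable M"
    and law: "\<And>n. distr M borel (Y n) = \<gamma> n"
    and close: "\<And>n. AE x in M. dist (snd (Y n x)) (fst (Y (Suc n) x)) \<le> d"
    using d by (elim coupling_chain[where e="\<lambda>_. d"]) auto
  interpret prob_space M by fact
  define A0 B0 A1 B1 where "A0 x = fst (Y 0 x)" and "B0 x = snd (Y 0 x)"
    and "A1 x = fst (Y 1 x)" and "B1 x = snd (Y 1 x)" for x
  have [measurable]: "A0 \<in> borel_measurable M" "B0 \<in> borel_measurable M"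
      "A1 \<in> borel_measurable M" "B1 \<in> borel_measurable M"
    by (simp_all add: A0_def[abs_def] B0_def[abs_def] A1_def[abs_def] B1_def[abs_def])
  have "distr M borel A0 = distr (\<gamma> 0) borel fst"
    by (subst law[symmetric]) (auto simp: distr_distr comp_def A0_def[abs_def])
  then have A0: "distr M borel A0 = a"
    using \<gamma>1(1) by (simp add: couplings_def \<gamma>_def)
  have "distr M borel B1 = distr (\<gamma> 1) borel snd"
    by (subst law[symmetric]) (auto simp: distr_distr comp_def B1_def[abs_def])
  then have B1: "distr M borel B1 = c"
    using \<gamma>2(1) by (simp add: couplings_def \<gamma>_def)
  have cost: "cost2 (\<gamma> n) = (\<integral>\<^sup>+ x. ennreal ((norm (fst (Y n x) - snd (Y n x)))\<^sup>2) \<partial>M)" for n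
    unfolding cost2_def by (subst law[symmetric]) (auto simp: nn_integral_distr)
  have i1: "(\<integral>\<^sup>+ x. ennreal ((norm (A0 x - B0 x))\<^sup>2) \<partial>M) \<le> ennreal ((W2 a b + d)\<^sup>2)"
    using \<gamma>1(2) cost[of 0] by (simp add: A0_def B0_def \<gamma>_def)
  have i2: "(\<integral>\<^sup>+ x. ennreal ((norm (A1 x - B1 x))\<^sup>2) \<partial>M) \<le> ennreal ((W2 b c + d)\<^sup>2)"
    using \<gamma>2(2) cost[of 1] by (simp add: A1_def B1_def \<gamma>_def)
  have i3: "(\<integral>\<^sup>+ x. ennreal ((d + norm (A1 x - B1 x))\<^sup>2) \<partial>M) \<le> ennreal ((d + (W2 b c + d))\<^sup>2)"
    by (rule nn_integral_L2_triangle[where g="\<lambda>_. d", OF _ _ _ _ i2])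
      (use d in \<open>auto simp: emeasure_space_1 intro: add_nonneg_nonneg\<close>)
  have close': "AE x in M. \<bar>norm (A0 x - B1 x)\<bar> \<le> norm (A0 x - B0 x) + (d + norm (A1 x - B1 x))"
    using close[of 0]
  proof eventually_elim
    case (elim x)
    have "norm (A0 x - B1 x) \<le> norm (A0 x - B0 x) + norm (B0 x - A1 x) + norm (A1 x - B1 x)"
      by norm
    then show ?case using elim by (simp add: dist_norm B0_def A1_def)
  qed
  have "W2sq a c \<le> (\<integral>\<^sup>+ x. ennreal ((norm (A0 x - B1 x))\<^sup>2) \<partial>M)"
    using W2sq_distr_le[OF M, of A0 B1] by (simp add: A0 B1)
  also have "\<dots> \<le> ennreal ((W2 a b + d + (d + (W2 b c + d)))\<^sup>2)"
    by (rule nn_integral_L2_triangle[OF _ _ close' i1 i3]) (use d in auto)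
  finally show "W2sq a c \<le> ennreal ((W2 a b + W2 b c + 3 * d)\<^sup>2)"
    by (simp add: algebra_simps)
qed

section \<open>\<open>P2\<close> as a pseudometric space\<close>

lemma P2_finite:
  assumes "a \<in> P2 w" "b \<in> P2 w"
  shows "W2sq a b < \<infinity>"
proof -
  have "W2sq a b \<le> ennreal ((W2 a w + W2 w b)\<^sup>2)"
    using assms by (intro W2sq_triangle) (auto simp: P2_def W2sq_commute)
  then show ?thesis by (rule le_less_trans) simp
qed

lemma P2_W2sq:
  assumes "a \<in> P2 w" "b \<in> P2 w"
  shows "W2sq a b = ennreal ((W2 a b)\<^sup>2)"
  by (rule W2sq_eq_W2[OF P2_finite[OF assms]])

lemma P2_triangle:
  assumes "a \<in> P2 w" "b \<in> P2 w" "c \<in> P2 w"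
  shows "W2 a c \<le> W2 a b + W2 b c"
  by (intro W2_leI W2sq_triangle P2_finite[of _ w]) (use assms in auto)

lemma P2_base: "w \<in> pmeas \<Longrightarrow> w \<in> P2 w"
  by (simp add: P2_def W2sq_self)

lemma P2_I:
  assumes "a \<in> P2 w" "b \<in> pmeas" "W2sq a b < \<infinity>"
  shows "b \<in> P2 w"
proof -
  have "W2sq b w \<le> ennreal ((W2 b a + W2 a w)\<^sup>2)"
    using assms by (intro W2sq_triangle) (auto simp: P2_def W2sq_commute)
  then have "W2sq b w < \<infinity>" by (rule le_less_trans) simp
  then show ?thesis using assms by (simp add: P2_def)
qed

section \<open>Completeness\<close>

text \<open>A geometric sum; the factor \<open>1 - (1/2)^k\<close> is kept because the induction
  does not close with the plain bound \<open>2 * c * (1/2)^n\<close>.\<close>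

lemma dyadic_dist_bound:
  fixes a :: "nat \<Rightarrow> 'a::metric_space"
  assumes "\<And>n. dist (a n) (a (Suc n)) \<le> c * (1/2)^n"
  shows "dist (a n) (a (n + k)) \<le> 2 * c * (1/2)^n * (1 - (1/2)^k)"
proof (induction k)
  case (Suc k)
  have "dist (a n) (a (n + Suc k)) \<le> dist (a n) (a (n + k)) + dist (a (n + k)) (a (Suc (n + k)))"
    using dist_triangle by simp
  also have "\<dots> \<le> 2 * c * (1/2)^n * (1 - (1/2)^k) + c * (1/2)^(n + k)"
    by (intro add_mono Suc assms)
  also have "\<dots> = 2 * c * (1/2)^n * (1 - (1/2)^Suc k)"
    by (simp add: power_add algebra_simps)
  finally show ?case .
qed simp

lemma power_4_eq_sq: "(4::real)^n = (2^n)\<^sup>2" "(1/4::real)^n = ((1/2)^n)\<^sup>2"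
  by (simp_all add: power2_eq_square flip: power_mult_distrib)

text \<open>Each single term of the weighted series bounds the \<open>n\<close>-th step by
  \<open>sqrt s * (1/2)^n\<close>, so the sequence is Cauchy and its tail is at most twice that;
  squaring gives the constant 4.\<close>

lemma norm_sq_diff_lim_le:
  fixes a :: "nat \<Rightarrow> 'a::banach"
  assumes fin: "(\<Sum>n. ennreal (4^n * (norm (a n - a (Suc n)))\<^sup>2)) < \<infinity>" (is "?S < _")
  shows "ennreal ((norm (a n - lim a))\<^sup>2) \<le> ennreal (4 * (1/4)^n) * ?S"
proof -
  define s where "s = enn2real ?S"
  have s: "?S = ennreal s" "s \<ge> 0" using fin by (auto simp: s_def)
  have "dist (a n) (a (Suc n)) \<le> sqrt s * (1/2)^n" for n
  proof -
    have "(\<Sum>n\<in>{n}. ennreal (4^n * (norm (a n - a (Suc n)))\<^sup>2)) \<le> ?S"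
      by (rule sum_le_suminf) auto
    then have "4^n * (norm (a n - a (Suc n)))\<^sup>2 \<le> s"
      using s by simp
    then have "(2^n * norm (a n - a (Suc n)))\<^sup>2 \<le> s"
      unfolding power_mult_distrib power_4_eq_sq .
    then have "2^n * norm (a n - a (Suc n)) \<le> sqrt s"
      by (rule real_le_rsqrt)
    then show ?thesis by (simp add: dist_norm field_simps)
  qed
  note bd = dyadic_dist_bound[OF this]
  have bd': "dist (a n) (a (n + k)) \<le> 2 * sqrt s * (1/2)^n" for n k
  proof -
    have "2 * sqrt s * (1/2)^n * (1 - (1/2)^k) \<le> 2 * sqrt s * (1/2)^n * 1"
      using s(2) by (intro mult_left_mono) auto
    then show ?thesis using bd[of n k] by simp
  qed
  have "Cauchy a"
  proof (rule metric_CauchyI)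
    fix e :: real assume "e > 0"
    have "(\<lambda>n. 2 * sqrt s * (1/2)^n) \<longlonglongrightarrow> 2 * sqrt s * 0"
      by (intro tendsto_intros LIMSEQ_power_zero) simp
    then have "\<forall>\<^sub>F n in sequentially. 2 * sqrt s * (1/2)^n < e / 2"
      using \<open>e > 0\<close> by (intro order_tendstoD) auto
    then obtain N where N: "2 * sqrt s * (1/2)^N < e / 2"
      by (auto simp: eventually_sequentially)
    have "dist (a m) (a n) < e" if "m \<ge> N" "n \<ge> N" for m n
      using bd'[of N "m - N"] bd'[of N "n - N"] N that dist_triangle3[of "a m" "a n" "a N"] by simp
    then show "\<exists>N. \<forall>m\<ge>N. \<forall>n\<ge>N. dist (a m) (a n) < e" by blast
  qed
  then have lim: "a \<longlonglongrightarrow> lim a"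
    by (simp add: Cauchy_convergent_iff convergent_LIMSEQ_iff)
  have "norm (a n - lim a) \<le> 2 * sqrt s * (1/2)^n"
  proof (rule tendsto_upperbound)
    show "(\<lambda>k. norm (a n - a (k + n))) \<longlonglongrightarrow> norm (a n - lim a)"
      by (intro tendsto_intros LIMSEQ_ignore_initial_segment lim)
    show "\<forall>\<^sub>F k in sequentially. norm (a n - a (k + n)) \<le> 2 * sqrt s * (1/2)^n"
      using bd'[of n] by (auto simp: dist_norm add.commute)
  qed simp
  then have "(norm (a n - lim a))\<^sup>2 \<le> (2 * sqrt s * (1/2)^n)\<^sup>2"
    by (intro power_mono) auto
  also have "\<dots> = 4 * (1/4)^n * s"
    using s(2) unfolding power_mult_distrib power_4_eq_sq by simp
  finally show "ennreal ((norm (a n - lim a))\<^sup>2) \<le> ennreal (4 * (1/4)^n) * ?S"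
    using s by (simp add: ennreal_leI flip: ennreal_mult)
qed

text \<open>The whole sequence is realized by random variables on one probability space; they
  converge almost surely, and the law of their limit is \<open>u\<close>.\<close>

lemma P2_complete:
  fixes v :: "nat \<Rightarrow> 'a::euclidean_space measure"
  assumes w: "w \<in> pmeas" and v: "\<And>n. v n \<in> P2 w"
    and fast: "\<And>n. W2 (v n) (v (Suc n)) \<le> (1/4)^n"
  obtains u where "u \<in> P2 w" "(\<lambda>n. W2 (v n) u) \<longlonglongrightarrow> 0"
proof -
  \<comment> \<open>The chain is \<open>v\<close> preceded by the base \<open>w\<close>, so
    \<open>v n\<close> is \<open>z (Suc n)\<close>.\<close>
  define z where "z n = (case n of 0 \<Rightarrow> w | Suc m \<Rightarrow> v m)" for n
  have z: "z n \<in> P2 w" for n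
    using v P2_base[OF w] by (auto simp: z_def split: nat.split)
  have "\<exists>\<gamma>\<in>couplings (z n) (z (Suc n)). cost2 \<gamma> \<le> ennreal ((W2 (z n) (z (Suc n)) + (1/4)^n)\<^sup>2)" for n
    by (rule near_optimal_coupling[OF P2_finite[OF z z], of "(1/4)^n" n "Suc n"]) auto
  then obtain \<gamma> where \<gamma>: "\<And>n. \<gamma> n \<in> couplings (z n) (z (Suc n))"
    and cost: "\<And>n. cost2 (\<gamma> n) \<le> ennreal ((W2 (z n) (z (Suc n)) + (1/4)^n)\<^sup>2)"
    by metis
  obtain M :: "(nat \<times> nat \<Rightarrow> 'a \<times> 'a) measure" and Y where M: "prob_space M"
    and Y[measurable]: "\<And>n. Y n \<in> borel_measurable M"
    and law: "\<And>n. distr M borel (Y n) = \<gamma> n"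
    and close: "\<And>n. AE x in M. dist (snd (Y n x)) (fst (Y (Suc n) x)) \<le> (1/4)^n"
    by (rule coupling_chain[where e="\<lambda>n. (1/4)^n" and \<gamma>=\<gamma> and z=z, OF \<gamma>]) auto
  interpret prob_space M by fact
  define A where "A n x = fst (Y n x)" for n x
  have A[measurable]: "A n \<in> borel_measurable M" for n
    unfolding A_def[abs_def] by measurable
  have lawA: "distr M borel (A n) = z n" for n
  proof -
    have "distr M borel (A n) = distr (\<gamma> n) borel fst"
      by (subst law[symmetric]) (auto simp: distr_distr comp_def A_def[abs_def])
    then show ?thesis using \<gamma>[of n] by (simp add: couplings_def)
  qed
  \<comment> \<open>For \<open>n > 0\<close> the index shift turns \<open>fast\<close> into
    \<open>4 * (1/4)^n\<close>, and near-optimality and gluing add one \<open>(1/4)^n\<close> each: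
    6 in all. The first step, from \<open>w\<close>, is merely finite and enters through
    \<open>W2 (z 0) (z 1)\<close>.\<close>
  define K where "K = 6 + W2 (z 0) (z 1)"
  have W_le: "W2 (z n) (z (Suc n)) + (1/4)^n + (1/4)^n \<le> K * (1/4)^n" for n
  proof (cases n)
    case (Suc m)
    have "W2 (z n) (z (Suc n)) \<le> 4 * (1/4)^n"
      using fast[of m] by (simp add: Suc z_def)
    moreover have "6 * (1/4)^n \<le> K * (1/4)^n"
      by (intro mult_right_mono) (auto simp: K_def)
    ultimately show ?thesis by linarith
  qed (simp add: K_def)
  have step: "(\<integral>\<^sup>+ x. ennreal ((norm (A n x - A (Suc n) x))\<^sup>2) \<partial>M) \<le> ennreal ((K * (1/4)^n)\<^sup>2)" for n
  proof -
    have "(\<integral>\<^sup>+ x. ennreal ((norm (A n x - A (Suc n) x))\<^sup>2) \<partial>M)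
        \<le> ennreal ((W2 (z n) (z (Suc n)) + (1/4)^n + (1/4)^n)\<^sup>2)"
    proof (rule nn_integral_L2_triangle[where h="\<lambda>_. (1/4)^n" and g="\<lambda>x. norm (fst (Y n x) - snd (Y n x))"])
      have "(\<integral>\<^sup>+ x. ennreal ((norm (fst (Y n x) - snd (Y n x)))\<^sup>2) \<partial>M) = cost2 (\<gamma> n)"
        unfolding cost2_def by (subst law[symmetric]) (auto simp: nn_integral_distr)
      then show "(\<integral>\<^sup>+ x. ennreal ((norm (fst (Y n x) - snd (Y n x)))\<^sup>2) \<partial>M)
          \<le> ennreal ((W2 (z n) (z (Suc n)) + (1/4)^n)\<^sup>2)"
        using cost by simp
      show "AE x in M. \<bar>norm (A n x - A (Suc n) x)\<bar> \<le> norm (fst (Y n x) - snd (Y n x)) + (1/4)^n"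
        using close[of n]
      proof eventually_elim
        case (elim x)
        have "norm (fst (Y n x) - fst (Y (Suc n) x)) \<le> norm (fst (Y n x) - snd (Y n x))
            + norm (snd (Y n x) - fst (Y (Suc n) x))"
          by norm
        then show ?case using elim by (simp add: dist_norm A_def)
      qed
    qed (auto simp: emeasure_space_1)
    also have "\<dots> \<le> ennreal ((K * (1/4)^n)\<^sup>2)"
      by (intro ennreal_leI power_mono W_le) auto
    finally show ?thesis .
  qed
  \<comment> \<open>The squared steps have integrals of order \<open>(1/16)^n\<close>; with weights
    \<open>4^n\<close> their sum is still finite, so \<open>S\<close> is finite almost
    everywhere.\<close>
  define S where "S x = (\<Sum>n. ennreal (4^n * (norm (A n x - A (Suc n) x))\<^sup>2))" for x
  have [measurable]: "S \<in> borel_measurable M" unfolding S_def[abs_def] by measurable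
  have "(\<integral>\<^sup>+ x. S x \<partial>M) = (\<Sum>n. (\<integral>\<^sup>+ x. ennreal (4^n * (norm (A n x - A (Suc n) x))\<^sup>2) \<partial>M))"
    unfolding S_def by (rule nn_integral_suminf) measurable
  also have "\<dots> \<le> (\<Sum>n. ennreal (K\<^sup>2 * (1/4)^n))"
  proof (rule suminf_le)
    fix n
    have "(\<integral>\<^sup>+ x. ennreal (4^n * (norm (A n x - A (Suc n) x))\<^sup>2) \<partial>M)
        = ennreal (4^n) * (\<integral>\<^sup>+ x. ennreal ((norm (A n x - A (Suc n) x))\<^sup>2) \<partial>M)"
      by (simp add: ennreal_mult nn_integral_cmult)
    also have "\<dots> \<le> ennreal (4^n) * ennreal ((K * (1/4)^n)\<^sup>2)"
      by (intro mult_left_mono step) simp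
    also have "\<dots> = ennreal (K\<^sup>2 * (1/4)^n)"
      by (simp add: power_mult_distrib power2_eq_square power_one_over flip: ennreal_mult)
    finally show "(\<integral>\<^sup>+ x. ennreal (4^n * (norm (A n x - A (Suc n) x))\<^sup>2) \<partial>M) \<le> ennreal (K\<^sup>2 * (1/4)^n)" .
  qed auto
  also have "\<dots> < \<infinity>"
    using summable_geometric[of "1/4 :: real"]
    by (subst suminf_ennreal2) (auto intro: summable_mult)
  finally have finS: "(\<integral>\<^sup>+ x. S x \<partial>M) < \<infinity>" .
  then have AE_S: "AE x in M. S x \<noteq> \<infinity>"
    by (intro nn_integral_PInf_AE) auto
  define C where "C = enn2real (\<integral>\<^sup>+ x. S x \<partial>M)"
  have C: "(\<integral>\<^sup>+ x. S x \<partial>M) = ennreal C" "C \<ge> 0" using finS by (simp_all add: C_def)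
  \<comment> \<open>Off the null set where \<open>S\<close> is infinite this is a genuine
    limit.\<close>
  define X where "X x = lim (\<lambda>n. A n x)" for x
  have X[measurable]: "X \<in> borel_measurable M"
    unfolding X_def[abs_def] by measurable
  define u where "u = distr M borel X"
  have W: "W2sq (z n) u \<le> ennreal (4 * (1/4)^n * C)" for n
  proof -
    have "W2sq (z n) u \<le> (\<integral>\<^sup>+ x. ennreal ((norm (A n x - X x))\<^sup>2) \<partial>M)"
      using W2sq_distr_le[OF M A X, of n] by (simp add: u_def lawA)
    also have "\<dots> \<le> (\<integral>\<^sup>+ x. ennreal (4 * (1/4)^n) * S x \<partial>M)"
    proof (rule nn_integral_mono_AE)
      show "AE x in M. ennreal ((norm (A n x - X x))\<^sup>2) \<le> ennreal (4 * (1/4)^n) * S x"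
        using AE_S
      proof eventually_elim
        case (elim x)
        then show ?case
          using norm_sq_diff_lim_le[of "\<lambda>n. A n x" n]
          by (simp add: S_def X_def less_top)
      qed
    qed
    also have "\<dots> = ennreal (4 * (1/4)^n * C)"
      using C by (simp add: nn_integral_cmult ennreal_mult)
    finally show ?thesis .
  qed
  have "u \<in> P2 w"
  proof (rule P2_I[OF z[of 0]])
    show "u \<in> pmeas" by (simp add: u_def pmeas_def prob_space_distr)
    show "W2sq (z 0) u < \<infinity>" using W[of 0] by (rule le_less_trans) simp
  qed
  moreover have "(\<lambda>n. W2 (v n) u) \<longlonglongrightarrow> 0"
  proof (rule tendsto_sandwich[where f="\<lambda>_. 0"])
    show "\<forall>\<^sub>F n in sequentially. W2 (v n) u \<le> sqrt C * (1/2)^n"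
    proof (intro always_eventually allI W2_leI)
      fix n
      have "4 * (1/4)^(Suc n) * C = (sqrt C * (1/2)^n)\<^sup>2"
        unfolding power_mult_distrib power_4_eq_sq by (simp add: C_def power2_eq_square)
      then show "W2sq (v n) u \<le> ennreal ((sqrt C * (1/2)^n)\<^sup>2)"
        using W[of "Suc n"] by (simp add: z_def)
    qed (simp add: C_def)
    have "(\<lambda>n. sqrt C * (1/2)^n) \<longlonglongrightarrow> sqrt C * 0"
      by (intro tendsto_intros LIMSEQ_power_zero) simp
    then show "(\<lambda>n. sqrt C * (1/2)^n) \<longlonglongrightarrow> 0" by simp
  qed auto
  ultimately show ?thesis by (rule that)
qed

section \<open>Generalized geodesics\<close>

text \<open>Integrated over a plan with \<open>x\<close> at the base, this identity yields convexity
  of the squared distance to the base along generalized geodesics.\<close>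

lemma norm_sq_interpolation:
  fixes x y z :: "'a::real_inner"
  shows "(norm (x - ((1 - a) *\<^sub>R y + a *\<^sub>R z)))\<^sup>2 + a * (1 - a) * (norm (y - z))\<^sup>2
    = (1 - a) * (norm (x - y))\<^sup>2 + a * (norm (x - z))\<^sup>2"
  unfolding power2_norm_eq_inner
  by (simp add: inner_diff_left inner_diff_right inner_add_left inner_add_right inner_commute algebra_simps)

context
  fixes w \<omega> \<mu>0 \<mu>1 :: "'a::euclidean_space measure" and \<Omega> :: "('a \<times> 'a \<times> 'a) measure"
  assumes \<Omega>: "\<Omega> \<in> transport_plans \<omega> \<mu>0 \<mu>1"
    and P2: "\<omega> \<in> P2 w" "\<mu>0 \<in> P2 w" "\<mu>1 \<in> P2 w"
begin

private lemma prob_plan: "prob_space \<Omega>" and sets_plan [measurable_cong]: "sets \<Omega> = sets borel"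
  using \<Omega> by (auto simp: transport_plans_def)

private lemma optimal_12: "distr \<Omega> borel (\<lambda>p. (fst p, fst (snd p))) \<in> opt_couplings \<omega> \<mu>0"
  and optimal_13: "distr \<Omega> borel (\<lambda>p. (fst p, snd (snd p))) \<in> opt_couplings \<omega> \<mu>1"
  using \<Omega> by (auto simp: transport_plans_def case_prod_beta')

private lemma distr_1: "distr \<Omega> borel fst = \<omega>"
  and distr_2: "distr \<Omega> borel (\<lambda>p. fst (snd p)) = \<mu>0"
  and distr_3: "distr \<Omega> borel (\<lambda>p. snd (snd p)) = \<mu>1"
  using optimal_12 optimal_13
  by (auto simp: opt_couplings_def couplings_def distr_distr comp_def)

private lemma cost_12: "(\<integral>\<^sup>+ p. ennreal ((norm (fst p - fst (snd p)))\<^sup>2) \<partial>\<Omega>) = ennreal ((W2 \<omega> \<mu>0)\<^sup>2)"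
  using optimal_12 P2_W2sq[OF P2(1,2)] by (auto simp: opt_couplings_def cost2_def nn_integral_distr)

private lemma cost_13: "(\<integral>\<^sup>+ p. ennreal ((norm (fst p - snd (snd p)))\<^sup>2) \<partial>\<Omega>) = ennreal ((W2 \<omega> \<mu>1)\<^sup>2)"
  using optimal_13 P2_W2sq[OF P2(1,3)] by (auto simp: opt_couplings_def cost2_def nn_integral_distr)

text \<open>Minkowski through the base point. The finiteness that follows makes the real number
  \<open>W2_plan\<close> faithful to the integral.\<close>

private lemma cost_23_le:
  "(\<integral>\<^sup>+ p. ennreal ((norm (fst (snd p) - snd (snd p)))\<^sup>2) \<partial>\<Omega>) \<le> ennreal ((W2 \<omega> \<mu>0 + W2 \<omega> \<mu>1)\<^sup>2)"
proof (rule nn_integral_L2_triangle[OF _ _ _ eq_refl[OF cost_12] eq_refl[OF cost_13]])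
  show "AE p in \<Omega>. \<bar>norm (fst (snd p) - snd (snd p))\<bar> \<le> norm (fst p - fst (snd p)) + norm (fst p - snd (snd p))"
    by (intro AE_I2) norm
qed auto

private lemma cost_23:
  "(\<integral>\<^sup>+ p. ennreal ((norm (fst (snd p) - snd (snd p)))\<^sup>2) \<partial>\<Omega>) = ennreal ((W2_plan \<Omega>)\<^sup>2)"
proof -
  have "(\<integral>\<^sup>+ p. ennreal ((norm (fst (snd p) - snd (snd p)))\<^sup>2) \<partial>\<Omega>) < \<infinity>"
    using cost_23_le by (rule le_less_trans) simp
  then show ?thesis by (simp add: W2_plan_def)
qed

lemma W2_plan_nonneg: "0 \<le> W2_plan \<Omega>"
  by (simp add: W2_plan_def)

lemma W2_plan_le: "W2_plan \<Omega> \<le> W2 \<omega> \<mu>0 + W2 \<omega> \<mu>1"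
  using cost_23_le by (simp add: cost_23 W2_plan_nonneg power2_le_iff_abs_le)

private lemma gen_geod_eq: "gen_geod \<Omega> \<alpha> = distr \<Omega> borel (\<lambda>p. (1 - \<alpha>) *\<^sub>R fst (snd p) + \<alpha> *\<^sub>R snd (snd p))"
  by (simp add: gen_geod_def case_prod_beta')

text \<open>The plan itself couples \<open>\<mu>0\<close> with the intermediate measure, and the
  displacement is \<open>\<alpha>\<close> times that between the endpoints.\<close>

lemma W2_start_gen_geod_le:
  assumes "0 \<le> \<alpha>"
  shows "W2 \<mu>0 (gen_geod \<Omega> \<alpha>) \<le> \<alpha> * W2_plan \<Omega>"
proof (rule W2_leI)
  have eq: "fst (snd p) - ((1 - \<alpha>) *\<^sub>R fst (snd p) + \<alpha> *\<^sub>R snd (snd p)) = \<alpha> *\<^sub>R (fst (snd p) - snd (snd p))"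
    for p :: "'a \<times> 'a \<times> 'a" by (simp add: algebra_simps)
  have "W2sq \<mu>0 (gen_geod \<Omega> \<alpha>)
      \<le> (\<integral>\<^sup>+ p. ennreal ((norm (fst (snd p) - ((1 - \<alpha>) *\<^sub>R fst (snd p) + \<alpha> *\<^sub>R snd (snd p))))\<^sup>2) \<partial>\<Omega>)"
    unfolding gen_geod_eq distr_2[symmetric] by (rule W2sq_distr_le[OF prob_plan]) measurable
  also have "\<dots> = ennreal (\<alpha>\<^sup>2) * ennreal ((W2_plan \<Omega>)\<^sup>2)"
    unfolding eq by (simp add: power_mult_distrib ennreal_mult nn_integral_cmult cost_23)
  finally show "W2sq \<mu>0 (gen_geod \<Omega> \<alpha>) \<le> ennreal ((\<alpha> * W2_plan \<Omega>)\<^sup>2)"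
    by (simp add: power_mult_distrib ennreal_mult)
qed (use assms W2_plan_nonneg in simp)

lemma W2_gen_geod_end_le:
  assumes "\<alpha> \<le> 1"
  shows "W2 (gen_geod \<Omega> \<alpha>) \<mu>1 \<le> (1 - \<alpha>) * W2_plan \<Omega>"
proof (rule W2_leI)
  have eq: "((1 - \<alpha>) *\<^sub>R fst (snd p) + \<alpha> *\<^sub>R snd (snd p)) - snd (snd p) = (1 - \<alpha>) *\<^sub>R (fst (snd p) - snd (snd p))"
    for p :: "'a \<times> 'a \<times> 'a" by (simp add: algebra_simps)
  have "W2sq (gen_geod \<Omega> \<alpha>) \<mu>1
      \<le> (\<integral>\<^sup>+ p. ennreal ((norm (((1 - \<alpha>) *\<^sub>R fst (snd p) + \<alpha> *\<^sub>R snd (snd p)) - snd (snd p)))\<^sup>2) \<partial>\<Omega>)"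
    unfolding gen_geod_eq distr_3[symmetric] by (rule W2sq_distr_le[OF prob_plan]) measurable
  also have "\<dots> = ennreal ((1 - \<alpha>)\<^sup>2) * ennreal ((W2_plan \<Omega>)\<^sup>2)"
    unfolding eq by (simp add: power_mult_distrib ennreal_mult nn_integral_cmult cost_23)
  finally show "W2sq (gen_geod \<Omega> \<alpha>) \<mu>1 \<le> ennreal (((1 - \<alpha>) * W2_plan \<Omega>)\<^sup>2)"
    by (simp add: power_mult_distrib ennreal_mult)
qed (use assms W2_plan_nonneg in simp)

lemma W2_le_W2_plan: "W2 \<mu>0 \<mu>1 \<le> W2_plan \<Omega>"
  using W2_start_gen_geod_le[of 1] by (simp add: gen_geod_eq distr_3)

text \<open>On the right the squared distances are exact because the plan is optimal from the base
  to either endpoint; on the left it induces some coupling of \<open>\<omega>\<close> with the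
  intermediate measure, which suffices for \<le>.\<close>

lemma
  assumes "0 \<le> \<alpha>" "\<alpha> \<le> 1"
  shows gen_geod_P2: "gen_geod \<Omega> \<alpha> \<in> P2 w"
    and W2_gen_geod_le: "(W2 \<omega> (gen_geod \<Omega> \<alpha>))\<^sup>2
      \<le> (1 - \<alpha>) * (W2 \<omega> \<mu>0)\<^sup>2 + \<alpha> * (W2 \<omega> \<mu>1)\<^sup>2 - \<alpha> * (1 - \<alpha>) * (W2_plan \<Omega>)\<^sup>2"
proof -
  let ?g = "\<lambda>p :: 'a \<times> 'a \<times> 'a. (1 - \<alpha>) *\<^sub>R fst (snd p) + \<alpha> *\<^sub>R snd (snd p)"
  let ?J = "\<integral>\<^sup>+ p. ennreal ((norm (fst p - ?g p))\<^sup>2) \<partial>\<Omega>"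
  have \<alpha>: "0 \<le> \<alpha> * (1 - \<alpha>)" using assms by simp
  \<comment> \<open>The \<open>W2_plan\<close> term is added on the left, which avoids subtraction
    in \<open>ennreal\<close> while finiteness of the distance is still open.\<close>
  have "?J + ennreal (\<alpha> * (1 - \<alpha>)) * ennreal ((W2_plan \<Omega>)\<^sup>2)
      = (\<integral>\<^sup>+ p. ennreal ((norm (fst p - ?g p))\<^sup>2 + \<alpha> * (1 - \<alpha>) * (norm (fst (snd p) - snd (snd p)))\<^sup>2) \<partial>\<Omega>)"
    using \<alpha> by (simp add: cost_23[symmetric] ennreal_mult nn_integral_add nn_integral_cmult)
  also have "\<dots> = (\<integral>\<^sup>+ p. ennreal ((1 - \<alpha>) * (norm (fst p - fst (snd p)))\<^sup>2 + \<alpha> * (norm (fst p - snd (snd p)))\<^sup>2) \<partial>\<Omega>)"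
    by (simp add: norm_sq_interpolation)
  also have "\<dots> = ennreal (1 - \<alpha>) * ennreal ((W2 \<omega> \<mu>0)\<^sup>2) + ennreal \<alpha> * ennreal ((W2 \<omega> \<mu>1)\<^sup>2)"
    using assms by (simp add: cost_12[symmetric] cost_13[symmetric] ennreal_mult nn_integral_add nn_integral_cmult)
  also have "\<dots> = ennreal ((1 - \<alpha>) * (W2 \<omega> \<mu>0)\<^sup>2 + \<alpha> * (W2 \<omega> \<mu>1)\<^sup>2)"
    using assms by (simp flip: ennreal_mult ennreal_plus)
  finally have J: "?J + ennreal (\<alpha> * (1 - \<alpha>) * (W2_plan \<Omega>)\<^sup>2)
      = ennreal ((1 - \<alpha>) * (W2 \<omega> \<mu>0)\<^sup>2 + \<alpha> * (W2 \<omega> \<mu>1)\<^sup>2)"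
    using \<alpha> by (simp add: ennreal_mult)
  have le: "W2sq \<omega> (gen_geod \<Omega> \<alpha>) \<le> ?J"
    unfolding gen_geod_eq distr_1[symmetric] by (rule W2sq_distr_le[OF prob_plan]) measurable
  then have le': "W2sq \<omega> (gen_geod \<Omega> \<alpha>) + ennreal (\<alpha> * (1 - \<alpha>) * (W2_plan \<Omega>)\<^sup>2)
      \<le> ennreal ((1 - \<alpha>) * (W2 \<omega> \<mu>0)\<^sup>2 + \<alpha> * (W2 \<omega> \<mu>1)\<^sup>2)"
    unfolding J[symmetric] by (rule add_right_mono)
  have "W2sq \<omega> (gen_geod \<Omega> \<alpha>) \<le> W2sq \<omega> (gen_geod \<Omega> \<alpha>) + ennreal (\<alpha> * (1 - \<alpha>) * (W2_plan \<Omega>)\<^sup>2)"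
    by simp
  also note le'
  finally have fin: "W2sq \<omega> (gen_geod \<Omega> \<alpha>) < \<infinity>"
    by (rule le_less_trans) simp
  show "gen_geod \<Omega> \<alpha> \<in> P2 w"
  proof (rule P2_I[OF P2(1) _ fin])
    show "gen_geod \<Omega> \<alpha> \<in> pmeas"
      unfolding pmeas_def gen_geod_eq by (auto intro!: prob_space.prob_space_distr[OF prob_plan])
  qed
  have "ennreal ((W2 \<omega> (gen_geod \<Omega> \<alpha>))\<^sup>2 + \<alpha> * (1 - \<alpha>) * (W2_plan \<Omega>)\<^sup>2)
      \<le> ennreal ((1 - \<alpha>) * (W2 \<omega> \<mu>0)\<^sup>2 + \<alpha> * (W2 \<omega> \<mu>1)\<^sup>2)"
    using le' \<alpha> unfolding W2sq_eq_W2[OF fin] by simp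
  then have "(W2 \<omega> (gen_geod \<Omega> \<alpha>))\<^sup>2 + \<alpha> * (1 - \<alpha>) * (W2_plan \<Omega>)\<^sup>2
      \<le> (1 - \<alpha>) * (W2 \<omega> \<mu>0)\<^sup>2 + \<alpha> * (W2 \<omega> \<mu>1)\<^sup>2"
    using assms by (subst (asm) ennreal_le_iff) auto
  then show "(W2 \<omega> (gen_geod \<Omega> \<alpha>))\<^sup>2
      \<le> (1 - \<alpha>) * (W2 \<omega> \<mu>0)\<^sup>2 + \<alpha> * (W2 \<omega> \<mu>1)\<^sup>2 - \<alpha> * (1 - \<alpha>) * (W2_plan \<Omega>)\<^sup>2"
    by simp
qed

end

section \<open>The proximal map\<close>

lemma le_diff_limit:
  fixes a b c :: real
  assumes "\<And>\<alpha>. 0 < \<alpha> \<Longrightarrow> \<alpha> < 1 \<Longrightarrow> a \<le> b - (1 - \<alpha>) * c"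
  shows "a \<le> b - c"
proof (rule tendsto_lowerbound)
  show "((\<lambda>\<alpha>. b - (1 - \<alpha>) * c) \<longlongrightarrow> b - c) (at_right 0)"
    by (auto intro!: tendsto_eq_intros)
  show "\<forall>\<^sub>F \<alpha> in at_right 0. a \<le> b - (1 - \<alpha>) * c"
    using eventually_at_right_less eventually_at_right_real[OF zero_less_one]
    by eventually_elim (use assms in auto)
qed simp

section \<open>Functionals convex along generalized geodesics\<close>

locale gg_functional =
  fixes w :: "'a::euclidean_space measure" and E :: "'a measure \<Rightarrow> ereal" and lam :: real
  assumes w: "w \<in> pmeas"
    and not_MInf: "\<And>\<rho>. \<rho> \<in> P2 w \<Longrightarrow> E \<rho> \<noteq> -\<infinity>"
    and proper: "proper w E"
    and coercive: "coercive w E"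
    and lsc: "W2_lsc w E"
    and gg: "gg_convex w E lam"
begin

text \<open>Faithful only on \<open>dom_E w E\<close>; elsewhere \<open>real_of_ereal\<close> turns
  \<infinity> into 0.\<close>

definition e :: "'a measure \<Rightarrow> real" where
  "e v = real_of_ereal (E v)"

definition prox_objective :: "real \<Rightarrow> 'a measure \<Rightarrow> 'a measure \<Rightarrow> real" where
  "prox_objective \<tau> \<mu> v = (W2 \<mu> v)\<^sup>2 / (2 * \<tau>) + e v"

lemma dom_P2: "v \<in> dom_E w E \<Longrightarrow> v \<in> P2 w"
  by (simp add: dom_E_def)

lemma dom_eq: "v \<in> dom_E w E \<Longrightarrow> E v = ereal (e v)"
  using not_MInf[of v] by (cases "E v") (auto simp: dom_E_def e_def)

lemma domI: "v \<in> P2 w \<Longrightarrow> E v \<le> ereal r \<Longrightarrow> v \<in> dom_E w E"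
  by (auto simp: dom_E_def intro: le_less_trans)

lemma W2_self: "v \<in> P2 w \<Longrightarrow> W2 v v = 0"
  by (simp add: W2_def W2sq_self P2_def)

text \<open>Between endpoints of finite energy the convexity bound is finite, so the whole geodesic
  stays in the domain and real arithmetic applies.\<close>

lemma convex_plan:
  assumes \<omega>: "\<omega> \<in> P2 w" and v: "v0 \<in> dom_E w E" "v1 \<in> dom_E w E"
  obtains \<Omega> where "\<Omega> \<in> transport_plans \<omega> v0 v1"
    "\<And>\<alpha>. 0 \<le> \<alpha> \<Longrightarrow> \<alpha> \<le> 1 \<Longrightarrow> gen_geod \<Omega> \<alpha> \<in> dom_E w E"
    "\<And>\<alpha>. 0 \<le> \<alpha> \<Longrightarrow> \<alpha> \<le> 1 \<Longrightarrow>
      e (gen_geod \<Omega> \<alpha>) \<le> (1 - \<alpha>) * e v0 + \<alpha> * e v1 - \<alpha> * (1 - \<alpha>) * (lam / 2) * (W2_plan \<Omega>)\<^sup>2"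
proof -
  obtain \<Omega> where \<Omega>: "\<Omega> \<in> transport_plans \<omega> v0 v1"
    and le: "\<And>\<alpha>. \<alpha> \<in> {0..1} \<Longrightarrow> E (gen_geod \<Omega> \<alpha>) \<le> ereal (1 - \<alpha>) * E v0 + ereal \<alpha> * E v1
                              - ereal (\<alpha> * (1 - \<alpha>) * (lam / 2) * (W2_plan \<Omega>)\<^sup>2)"
    using gg \<omega> v dom_P2 unfolding gg_convex_def by meson
  have le': "E (gen_geod \<Omega> \<alpha>)
      \<le> ereal ((1 - \<alpha>) * e v0 + \<alpha> * e v1 - \<alpha> * (1 - \<alpha>) * (lam / 2) * (W2_plan \<Omega>)\<^sup>2)"
    if "0 \<le> \<alpha>" "\<alpha> \<le> 1" for \<alpha>
    using le[of \<alpha>] that by (simp add: dom_eq v)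
  have dom: "gen_geod \<Omega> \<alpha> \<in> dom_E w E" if "0 \<le> \<alpha>" "\<alpha> \<le> 1" for \<alpha>
    using le'[OF that] gen_geod_P2[OF \<Omega> \<omega> v[THEN dom_P2] that] by (rule domI[rotated])
  show ?thesis
    by (rule that[OF \<Omega> dom]) (use le' dom dom_eq in auto)
qed

text \<open>Taking \<open>\<mu>\<close> as the base lets one plan serve both summands: the quadratic
  term contributes \<open>1 / \<tau>\<close> to the modulus and the energy contributes
  \<open>lam\<close>.\<close>

lemma prox_objective_plan:
  assumes \<mu>: "\<mu> \<in> P2 w" and v: "v0 \<in> dom_E w E" "v1 \<in> dom_E w E" and \<tau>: "\<tau> > 0"
  obtains \<Omega> where "\<Omega> \<in> transport_plans \<mu> v0 v1"
    "\<And>\<alpha>. 0 \<le> \<alpha> \<Longrightarrow> \<alpha> \<le> 1 \<Longrightarrow> gen_geod \<Omega> \<alpha> \<in> dom_E w E"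
    "\<And>\<alpha>. 0 \<le> \<alpha> \<Longrightarrow> \<alpha> \<le> 1 \<Longrightarrow> prox_objective \<tau> \<mu> (gen_geod \<Omega> \<alpha>)
      \<le> (1 - \<alpha>) * prox_objective \<tau> \<mu> v0 + \<alpha> * prox_objective \<tau> \<mu> v1
        - \<alpha> * (1 - \<alpha>) * ((1 / \<tau> + lam) / 2 * (W2_plan \<Omega>)\<^sup>2)"
proof -
  obtain \<Omega> where \<Omega>: "\<Omega> \<in> transport_plans \<mu> v0 v1"
    and dom: "\<And>\<alpha>. 0 \<le> \<alpha> \<Longrightarrow> \<alpha> \<le> 1 \<Longrightarrow> gen_geod \<Omega> \<alpha> \<in> dom_E w E"
    and le: "\<And>\<alpha>. 0 \<le> \<alpha> \<Longrightarrow> \<alpha> \<le> 1 \<Longrightarrow>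
      e (gen_geod \<Omega> \<alpha>) \<le> (1 - \<alpha>) * e v0 + \<alpha> * e v1 - \<alpha> * (1 - \<alpha>) * (lam / 2) * (W2_plan \<Omega>)\<^sup>2"
    using convex_plan[OF \<mu> v] by metis
  show ?thesis
  proof (rule that[OF \<Omega> dom])
    fix \<alpha> :: real assume \<alpha>: "0 \<le> \<alpha>" "\<alpha> \<le> 1"
    have "(W2 \<mu> (gen_geod \<Omega> \<alpha>))\<^sup>2 / (2 * \<tau>)
        \<le> ((1 - \<alpha>) * (W2 \<mu> v0)\<^sup>2 + \<alpha> * (W2 \<mu> v1)\<^sup>2 - \<alpha> * (1 - \<alpha>) * (W2_plan \<Omega>)\<^sup>2) / (2 * \<tau>)"
      using W2_gen_geod_le[OF \<Omega> \<mu> v[THEN dom_P2] \<alpha>] \<tau> by (intro divide_right_mono) auto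
    also have "\<dots> = (1 - \<alpha>) * ((W2 \<mu> v0)\<^sup>2 / (2 * \<tau>)) + \<alpha> * ((W2 \<mu> v1)\<^sup>2 / (2 * \<tau>))
        - \<alpha> * (1 - \<alpha>) * (1 / \<tau> / 2 * (W2_plan \<Omega>)\<^sup>2)"
      using \<tau> by (simp add: field_simps)
    finally show "prox_objective \<tau> \<mu> (gen_geod \<Omega> \<alpha>)
      \<le> (1 - \<alpha>) * prox_objective \<tau> \<mu> v0 + \<alpha> * prox_objective \<tau> \<mu> v1
        - \<alpha> * (1 - \<alpha>) * ((1 / \<tau> + lam) / 2 * (W2_plan \<Omega>)\<^sup>2)"
      using le[OF \<alpha>] unfolding prox_objective_def by (simp add: algebra_simps add_divide_distrib)
  qed
qed

section \<open>Existence of proximal points\<close>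

lemma bounded_below_on_ball:
  assumes "v0 \<in> P2 w"
  obtains K where "K \<ge> 0" "\<And>v. v \<in> dom_E w E \<Longrightarrow> W2 v0 v \<le> 2 \<Longrightarrow> - K \<le> e v"
proof -
  obtain \<tau>0 u0 where \<tau>0: "\<tau>0 > 0" and u0: "u0 \<in> P2 w"
    and "(INF v\<in>P2 w. ereal ((W2 u0 v)\<^sup>2 / (2 * \<tau>0)) + E v) > -\<infinity>"
    using coercive unfolding coercive_def by blast
  then obtain C where C: "ereal C < (INF v\<in>P2 w. ereal ((W2 u0 v)\<^sup>2 / (2 * \<tau>0)) + E v)"
    using ereal_dense2[of "-\<infinity>"] by auto
  \<comment> \<open>Coercivity bounds the energy below up to a quadratic in the distance to
    \<open>u0\<close>, which is bounded on the ball around \<open>v0\<close>.\<close>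
  define K where "K = \<bar>C - (W2 u0 v0 + 2)\<^sup>2 / (2 * \<tau>0)\<bar>"
  have "- K \<le> e v" if v: "v \<in> dom_E w E" and d: "W2 v0 v \<le> 2" for v
  proof -
    have "ereal C \<le> ereal ((W2 u0 v)\<^sup>2 / (2 * \<tau>0)) + E v"
      using C dom_P2[OF v] by (meson INF_lower less_imp_le order_trans)
    then have "C \<le> (W2 u0 v)\<^sup>2 / (2 * \<tau>0) + e v"
      by (simp add: dom_eq[OF v])
    moreover have "W2 u0 v \<le> W2 u0 v0 + 2"
      using P2_triangle[OF u0 assms dom_P2[OF v]] d by simp
    then have "(W2 u0 v)\<^sup>2 / (2 * \<tau>0) \<le> (W2 u0 v0 + 2)\<^sup>2 / (2 * \<tau>0)"
      using \<tau>0 by (intro divide_right_mono power_mono) auto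
    ultimately show ?thesis by (simp add: K_def)
  qed
  then show ?thesis by (intro that[of K]) (auto simp: K_def)
qed

text \<open>A strongly convex function that is bounded below on a ball around \<open>v0\<close> is bounded below:
  for a far away \<open>v\<close>, compare it with the point of the geodesic from \<open>v0\<close> to \<open>v\<close> lying on the
  unit ball.\<close>

lemma prox_objective_bounded_below:
  assumes \<mu>: "\<mu> \<in> P2 w" and \<tau>: "\<tau> > 0" and m: "1 / \<tau> + lam > 0"
  shows "bdd_below (prox_objective \<tau> \<mu> ` dom_E w E)"
proof -
  obtain v0 where v0: "v0 \<in> dom_E w E" using proper by (auto simp: proper_def)
  obtain K where K: "K \<ge> 0" and ball: "\<And>v. v \<in> dom_E w E \<Longrightarrow> W2 v0 v \<le> 2 \<Longrightarrow> - K \<le> e v"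
    by (rule bounded_below_on_ball[OF dom_P2[OF v0]]) blast
  have ball': "- K \<le> prox_objective \<tau> \<mu> v" if "v \<in> dom_E w E" "W2 v0 v \<le> 2" for v
    using ball[OF that] \<tau> by (simp add: prox_objective_def add_increasing)
  define m where "m = 1 / \<tau> + lam"
  have m0: "m > 0" using m by (simp add: m_def)
  define N where "N = K + \<bar>prox_objective \<tau> \<mu> v0\<bar>"
  have "min (- K) (- (N\<^sup>2 / m)) \<le> prox_objective \<tau> \<mu> v" if v: "v \<in> dom_E w E" for v
  proof -
    obtain \<Omega> where \<Omega>: "\<Omega> \<in> transport_plans \<mu> v0 v"
      and dom: "\<And>\<alpha>. 0 \<le> \<alpha> \<Longrightarrow> \<alpha> \<le> 1 \<Longrightarrow> gen_geod \<Omega> \<alpha> \<in> dom_E w E"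
      and le: "\<And>\<alpha>. 0 \<le> \<alpha> \<Longrightarrow> \<alpha> \<le> 1 \<Longrightarrow> prox_objective \<tau> \<mu> (gen_geod \<Omega> \<alpha>)
        \<le> (1 - \<alpha>) * prox_objective \<tau> \<mu> v0 + \<alpha> * prox_objective \<tau> \<mu> v
          - \<alpha> * (1 - \<alpha>) * ((1 / \<tau> + lam) / 2 * (W2_plan \<Omega>)\<^sup>2)"
      using prox_objective_plan[OF \<mu> v0 v \<tau>] by metis
    note plan = \<Omega> \<mu> dom_P2[OF v0] dom_P2[OF v]
    define R where "R = W2_plan \<Omega>"
    show ?thesis
    \<comment> \<open>If \<open>R \<le> 2\<close>, then \<open>v\<close> itself lies in the ball.
      Otherwise \<open>1 / R\<close> is an admissible parameter whose point has distance at most 1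
      from \<open>v0\<close>, and \<open>R - 1 \<ge> R / 2\<close> keeps the quadratic term.\<close>
    proof (cases "R \<le> 2")
      case True
      then show ?thesis using ball'[OF v] W2_le_W2_plan[OF plan] by (simp add: R_def)
    next
      case False
      define P where "P = prox_objective \<tau> \<mu> v"
      define P0 where "P0 = prox_objective \<tau> \<mu> v0"
      have \<alpha>: "0 \<le> 1 / R" "1 / R \<le> 1" using False by auto
      have "W2 v0 (gen_geod \<Omega> (1 / R)) \<le> 1 / R * R"
        using W2_start_gen_geod_le[OF plan \<alpha>(1)] by (simp add: R_def)
      then have "- K \<le> prox_objective \<tau> \<mu> (gen_geod \<Omega> (1 / R))"
        using False by (intro ball' dom \<alpha>) auto
      then have "- K \<le> (1 - 1 / R) * P0 + 1 / R * P - 1 / R * (1 - 1 / R) * (m / 2 * R\<^sup>2)"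
        using le[OF \<alpha>] by (simp add: P_def P0_def m_def R_def)
      then have "R * (- K) \<le> R * ((1 - 1 / R) * P0 + 1 / R * P - 1 / R * (1 - 1 / R) * (m / 2 * R\<^sup>2))"
        using False by (intro mult_left_mono) auto
      also have "\<dots> = (R - 1) * P0 + P - (R - 1) * (m / 2) * R"
        using False by (simp add: field_simps power2_eq_square)
      finally have 1: "(R - 1) * (m / 2) * R - (R - 1) * P0 - R * K \<le> P" by simp
      have "(R - 1) * P0 \<le> R * \<bar>P0\<bar>"
        using False by (intro order_trans[OF mult_left_mono[OF abs_ge_self] mult_right_mono]) auto
      moreover have "R / 2 * (m / 2) * R \<le> (R - 1) * (m / 2) * R"
        using False m0 by (intro mult_right_mono) auto
      moreover have "R * N = R * K + R * \<bar>P0\<bar>"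
        by (simp add: N_def P0_def distrib_left)
      ultimately have "R / 2 * (m / 2) * R - R * N \<le> P"
        using 1 by linarith
      \<comment> \<open>Completing the square in \<open>R\<close> removes the dependence on
        \<open>v\<close>.\<close>
      moreover have "R / 2 * (m / 2) * R - R * N = (m * R / 2 - N)\<^sup>2 / m - N\<^sup>2 / m"
        using m0 by (simp add: field_simps power2_eq_square)
      moreover have "(m * R / 2 - N)\<^sup>2 / m \<ge> 0" using m0 by simp
      ultimately show ?thesis by (simp add: P_def)
    qed
  qed
  then show ?thesis by (rule bdd_belowI2)
qed

text \<open>The direct method: convexity at midpoints makes a minimizing sequence Cauchy,
  completeness provides the limit, and lower semicontinuity shows that it minimizes.\<close>

lemma prox_objective_minimizer:
  assumes \<mu>: "\<mu> \<in> P2 w" and \<tau>: "\<tau> > 0" and m: "1 / \<tau> + lam > 0"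
  obtains u where "u \<in> dom_E w E" "\<And>v. v \<in> dom_E w E \<Longrightarrow> prox_objective \<tau> \<mu> u \<le> prox_objective \<tau> \<mu> v"
proof -
  note bdd = prox_objective_bounded_below[OF \<mu> \<tau> m]
  define m where "m = 1 / \<tau> + lam"
  have m0: "m > 0" using m by (simp add: m_def)
  define I where "I = (INF v\<in>dom_E w E. prox_objective \<tau> \<mu> v)"
  have I: "I \<le> prox_objective \<tau> \<mu> v" if "v \<in> dom_E w E" for v
    unfolding I_def by (rule cINF_lower[OF bdd that])
  \<comment> \<open>At the midpoint, convexity gains
    \<open>m / 8 * (W2_plan \<Omega>)\<^sup>2\<close>, so this excess forces distances at most
    \<open>(1/4)^n\<close>, the rate that \<open>P2_complete\<close> asks for.\<close>
  define d where "d n = m / 8 * (1/16)^n" for n :: nat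
  have d: "d n > 0" "d (Suc n) \<le> d n" for n using m0 by (auto simp: d_def)
  have "\<exists>v\<in>dom_E w E. prox_objective \<tau> \<mu> v < I + d n" for n
    using cINF_less_iff[OF _ bdd, of "I + d n"] d(1)[of n] proper
    by (auto simp: proper_def I_def[symmetric])
  then obtain v where v: "\<And>n. v n \<in> dom_E w E" and vI: "\<And>n. prox_objective \<tau> \<mu> (v n) < I + d n"
    by metis
  have fast: "W2 (v n) (v (Suc n)) \<le> (1/4)^n" for n
  proof -
    obtain \<Omega> where \<Omega>: "\<Omega> \<in> transport_plans \<mu> (v n) (v (Suc n))"
      and dom: "\<And>\<alpha>. 0 \<le> \<alpha> \<Longrightarrow> \<alpha> \<le> 1 \<Longrightarrow> gen_geod \<Omega> \<alpha> \<in> dom_E w E"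
      and le: "\<And>\<alpha>. 0 \<le> \<alpha> \<Longrightarrow> \<alpha> \<le> 1 \<Longrightarrow> prox_objective \<tau> \<mu> (gen_geod \<Omega> \<alpha>)
        \<le> (1 - \<alpha>) * prox_objective \<tau> \<mu> (v n) + \<alpha> * prox_objective \<tau> \<mu> (v (Suc n))
          - \<alpha> * (1 - \<alpha>) * ((1 / \<tau> + lam) / 2 * (W2_plan \<Omega>)\<^sup>2)"
      using prox_objective_plan[OF \<mu> v v \<tau>] by metis
    have "I \<le> prox_objective \<tau> \<mu> (gen_geod \<Omega> (1/2))"
      by (intro I dom) auto
    also have "\<dots> \<le> (prox_objective \<tau> \<mu> (v n) + prox_objective \<tau> \<mu> (v (Suc n))) / 2 - m / 8 * (W2_plan \<Omega>)\<^sup>2"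
      using le[of "1/2"] by (simp add: m_def field_simps)
    also have "\<dots> \<le> I + d n - m / 8 * (W2_plan \<Omega>)\<^sup>2"
      using vI[of n] vI[of "Suc n"] d(2)[of n] by (simp add: field_simps)
    finally have "m / 8 * (W2_plan \<Omega>)\<^sup>2 \<le> m / 8 * (1/16)^n" by (simp add: d_def)
    then have "(W2_plan \<Omega>)\<^sup>2 \<le> (1/16)^n" using m0 by simp
    also have "(1/16::real)^n = ((1/4)^n)\<^sup>2"
      by (simp add: power2_eq_square flip: power_mult_distrib)
    finally have "W2_plan \<Omega> \<le> (1/4)^n"
      by (rule power2_le_imp_le) simp
    then show ?thesis
      using W2_le_W2_plan[OF \<Omega> \<mu> v[THEN dom_P2] v[THEN dom_P2]] by simp
  qed
  obtain u where u: "u \<in> P2 w" and lim: "(\<lambda>n. W2 (v n) u) \<longlonglongrightarrow> 0"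
    using P2_complete[OF w dom_P2[OF v] fast] by blast
  have W: "(\<lambda>n. W2 \<mu> (v n)) \<longlonglongrightarrow> W2 \<mu> u"
  proof (rule LIM_zero_cancel, rule Lim_null_comparison[OF _ lim])
    have "\<bar>W2 \<mu> (v n) - W2 \<mu> u\<bar> \<le> W2 (v n) u" for n
      using P2_triangle[OF \<mu> dom_P2[OF v[of n]] u] P2_triangle[OF \<mu> u dom_P2[OF v[of n]]]
      by (simp add: W2_commute[of u] abs_le_iff)
    then show "\<forall>\<^sub>F n in sequentially. norm (W2 \<mu> (v n) - W2 \<mu> u) \<le> W2 (v n) u" by simp
  qed
  have obj: "(\<lambda>n. prox_objective \<tau> \<mu> (v n)) \<longlonglongrightarrow> I"
  proof (rule tendsto_sandwich[where f="\<lambda>_. I"])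
    have "(\<lambda>n. I + d n) \<longlonglongrightarrow> I + m / 8 * 0"
      unfolding d_def by (intro tendsto_intros LIMSEQ_power_zero) simp
    then show "(\<lambda>n. I + d n) \<longlonglongrightarrow> I" by simp
    show "\<forall>\<^sub>F n in sequentially. prox_objective \<tau> \<mu> (v n) \<le> I + d n"
      using vI by (intro always_eventually allI less_imp_le)
  qed (use I v in auto)
  \<comment> \<open>The distances to \<open>\<mu>\<close> converge, so the energies along the
    sequence converge as well, and lower semicontinuity compares their limit with
    \<open>E u\<close>.\<close>
  have "(\<lambda>n. prox_objective \<tau> \<mu> (v n) - (W2 \<mu> (v n))\<^sup>2 / (2 * \<tau>)) \<longlonglongrightarrow> I - (W2 \<mu> u)\<^sup>2 / (2 * \<tau>)"
    using \<tau> by (intro tendsto_intros obj W) auto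
  then have "(\<lambda>n. E (v n)) \<longlonglongrightarrow> ereal (I - (W2 \<mu> u)\<^sup>2 / (2 * \<tau>))"
    using v by (simp add: prox_objective_def dom_eq)
  then have "liminf (\<lambda>n. E (v n)) = ereal (I - (W2 \<mu> u)\<^sup>2 / (2 * \<tau>))"
    by (intro lim_imp_Liminf) auto
  then have Eu: "E u \<le> ereal (I - (W2 \<mu> u)\<^sup>2 / (2 * \<tau>))"
    using lsc[unfolded W2_lsc_def, rule_format, of v u] v dom_P2 u lim by auto
  then have dom_u: "u \<in> dom_E w E" by (rule domI[OF u])
  then have "prox_objective \<tau> \<mu> u \<le> I"
    using Eu by (simp add: dom_eq prox_objective_def)
  then show ?thesis using that[OF dom_u] I by (meson order_trans)
qed

text \<open>Outside the domain the energy is \<infinity>, so a minimizer over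
  \<open>dom_E w E\<close> minimizes over all of \<open>P2 w\<close>; this gives the
  \<open>SOME\<close> in \<open>prox\<close> its defining property.\<close>

lemma
  assumes \<mu>: "\<mu> \<in> P2 w" and \<tau>: "\<tau> > 0" and m: "1 / \<tau> + lam > 0"
  shows prox_dom: "prox w E \<tau> \<mu> \<in> dom_E w E"
    and prox_minimal: "v \<in> dom_E w E \<Longrightarrow> prox_objective \<tau> \<mu> (prox w E \<tau> \<mu>) \<le> prox_objective \<tau> \<mu> v"
proof -
  let ?P = "\<lambda>\<nu>. \<nu> \<in> P2 w \<and> (\<forall>\<rho>\<in>P2 w.
      ereal ((W2 \<mu> \<nu>)\<^sup>2 / (2 * \<tau>)) + E \<nu> \<le> ereal ((W2 \<mu> \<rho>)\<^sup>2 / (2 * \<tau>)) + E \<rho>)"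
  obtain u where u: "u \<in> dom_E w E"
    and min: "\<And>v. v \<in> dom_E w E \<Longrightarrow> prox_objective \<tau> \<mu> u \<le> prox_objective \<tau> \<mu> v"
    by (rule prox_objective_minimizer[OF assms]) blast
  have "ereal ((W2 \<mu> u)\<^sup>2 / (2 * \<tau>)) + E u \<le> ereal ((W2 \<mu> \<rho>)\<^sup>2 / (2 * \<tau>)) + E \<rho>" if "\<rho> \<in> P2 w" for \<rho>
  proof (cases "\<rho> \<in> dom_E w E")
    case True
    then show ?thesis using min[OF True] by (simp add: dom_eq u prox_objective_def)
  next
    case False
    then have "E \<rho> = \<infinity>" using that by (simp add: dom_E_def)
    then show ?thesis by simp
  qed
  then have "?P u" using dom_P2[OF u] by blast
  then have P: "?P (prox w E \<tau> \<mu>)" unfolding prox_def by (rule someI[where P="?P"])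
  then have "ereal ((W2 \<mu> (prox w E \<tau> \<mu>))\<^sup>2 / (2 * \<tau>)) + E (prox w E \<tau> \<mu>) \<le> ereal (prox_objective \<tau> \<mu> u)"
    using dom_P2[OF u] by (auto simp: prox_objective_def dom_eq[OF u] simp flip: plus_ereal.simps)
  then show dom: "prox w E \<tau> \<mu> \<in> dom_E w E"
    using P by (cases "E (prox w E \<tau> \<mu>)") (auto simp: dom_E_def)
  show "prox_objective \<tau> \<mu> (prox w E \<tau> \<mu>) \<le> prox_objective \<tau> \<mu> v" if v: "v \<in> dom_E w E"
    using P dom_P2[OF v] dom by (auto simp: prox_objective_def dom_eq[OF v] dom_eq[OF dom])
qed

section \<open>Discrete variational inequality\<close>

lemma discrete_variational_inequality:
  assumes \<mu>: "\<mu> \<in> P2 w" and \<tau>: "\<tau> > 0" and m: "1 / \<tau> + lam > 0" and v: "v \<in> dom_E w E"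
  shows "(1 + lam * \<tau>) * (W2 (prox w E \<tau> \<mu>) v)\<^sup>2
    \<le> (W2 \<mu> v)\<^sup>2 + 2 * \<tau> * (e v - e (prox w E \<tau> \<mu>)) - (W2 \<mu> (prox w E \<tau> \<mu>))\<^sup>2"
proof -
  define J where "J = prox w E \<tau> \<mu>"
  have J: "J \<in> dom_E w E" unfolding J_def by (rule prox_dom[OF \<mu> \<tau> m])
  obtain \<Omega> where \<Omega>: "\<Omega> \<in> transport_plans \<mu> J v"
    and dom: "\<And>\<alpha>. 0 \<le> \<alpha> \<Longrightarrow> \<alpha> \<le> 1 \<Longrightarrow> gen_geod \<Omega> \<alpha> \<in> dom_E w E"
    and le: "\<And>\<alpha>. 0 \<le> \<alpha> \<Longrightarrow> \<alpha> \<le> 1 \<Longrightarrow> prox_objective \<tau> \<mu> (gen_geod \<Omega> \<alpha>)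
      \<le> (1 - \<alpha>) * prox_objective \<tau> \<mu> J + \<alpha> * prox_objective \<tau> \<mu> v
        - \<alpha> * (1 - \<alpha>) * ((1 / \<tau> + lam) / 2 * (W2_plan \<Omega>)\<^sup>2)"
    using prox_objective_plan[OF \<mu> J v \<tau>] by metis
  have "prox_objective \<tau> \<mu> J \<le> prox_objective \<tau> \<mu> v - (1 / \<tau> + lam) / 2 * (W2_plan \<Omega>)\<^sup>2"
  proof (rule le_diff_limit)
    fix \<alpha> :: real assume \<alpha>: "0 < \<alpha>" "\<alpha> < 1"
    have "prox_objective \<tau> \<mu> J \<le> prox_objective \<tau> \<mu> (gen_geod \<Omega> \<alpha>)"
      unfolding J_def using \<alpha> by (intro prox_minimal \<mu> \<tau> m dom) auto
    \<comment> \<open>Moving \<open>(1 - \<alpha>)\<close> times the value at \<open>J\<close> to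
      the left leaves a factor \<open>\<alpha>\<close> on both sides; dividing by it and letting
      \<alpha> tend to 0 yields the full modulus.\<close>
    also note le[of \<alpha>]
    finally have "\<alpha> * prox_objective \<tau> \<mu> J
        \<le> \<alpha> * (prox_objective \<tau> \<mu> v - (1 - \<alpha>) * ((1 / \<tau> + lam) / 2 * (W2_plan \<Omega>)\<^sup>2))"
      using \<alpha> by (simp add: algebra_simps)
    then show "prox_objective \<tau> \<mu> J
        \<le> prox_objective \<tau> \<mu> v - (1 - \<alpha>) * ((1 / \<tau> + lam) / 2 * (W2_plan \<Omega>)\<^sup>2)"
      using \<alpha>(1) by (rule mult_left_le_imp_le)
  qed
  moreover have "(1 / \<tau> + lam) / 2 * (W2 J v)\<^sup>2 \<le> (1 / \<tau> + lam) / 2 * (W2_plan \<Omega>)\<^sup>2"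
    using m W2_le_W2_plan[OF \<Omega> \<mu> dom_P2[OF J] dom_P2[OF v]]
    by (intro mult_left_mono power_mono) auto
  ultimately have "prox_objective \<tau> \<mu> J \<le> prox_objective \<tau> \<mu> v - (1 / \<tau> + lam) / 2 * (W2 J v)\<^sup>2"
    by linarith
  then have "2 * \<tau> * prox_objective \<tau> \<mu> J
      \<le> 2 * \<tau> * (prox_objective \<tau> \<mu> v - (1 / \<tau> + lam) / 2 * (W2 J v)\<^sup>2)"
    using \<tau> by (intro mult_left_mono) auto
  moreover have "2 * \<tau> * prox_objective \<tau> \<mu> J = (W2 \<mu> J)\<^sup>2 + 2 * \<tau> * e J"
    using \<tau> by (simp add: prox_objective_def distrib_left)
  moreover have "2 * \<tau> * (prox_objective \<tau> \<mu> v - (1 / \<tau> + lam) / 2 * (W2 J v)\<^sup>2)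
      = (W2 \<mu> v)\<^sup>2 + 2 * \<tau> * e v - (1 + lam * \<tau>) * (W2 J v)\<^sup>2"
    using \<tau> by (simp add: prox_objective_def field_simps)
  ultimately show ?thesis
    unfolding J_def[symmetric] right_diff_distrib[of "2 * \<tau>" "e v"] by linarith
qed

end

section \<open>Almost contraction\<close>

context gg_functional
begin

text \<open>The difference quotients of \<open>E\<close> along the geodesic from
  \<open>\<mu>\<close> to \<open>v\<close> are at least \<open>q \<alpha>\<close>, so the slope
  dominates the limit \<open>q 0\<close>; multiplied by the distance this is the claim.\<close>

lemma slope_inequality:
  assumes \<mu>: "\<mu> \<in> dom_slope w E" and v: "v \<in> dom_E w E"
  shows "e \<mu> - e v \<le> real_of_ereal (slope w E \<mu>) * W2 \<mu> v - lam / 2 * (W2 \<mu> v)\<^sup>2"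
proof -
  have dom\<mu>: "\<mu> \<in> dom_E w E" and fin: "slope w E \<mu> < \<infinity>"
    using \<mu> by (auto simp: dom_slope_def)
  define W where "W = W2 \<mu> v"
  show ?thesis
  \<comment> \<open>\<open>slope\<close> ignores points at distance 0; for them lower semicontinuity
    along a constant sequence gives the energy inequality.\<close>
  proof (cases "W = 0")
    case True
    then have "E \<mu> \<le> liminf (\<lambda>_ :: nat. E v)"
      using lsc[unfolded W2_lsc_def, rule_format, of "\<lambda>_. v" \<mu>] dom_P2[OF dom\<mu>] dom_P2[OF v]
      by (simp add: W_def W2_commute)
    then show ?thesis
      using True by (simp add: W_def Liminf_const dom_eq[OF dom\<mu>] dom_eq[OF v])
  next
    case False
    then have W: "W > 0" unfolding W_def using W2_nonneg[of \<mu> v] by linarith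
    obtain \<Omega> where \<Omega>: "\<Omega> \<in> transport_plans \<mu> \<mu> v"
      and dom: "\<And>\<alpha>. 0 \<le> \<alpha> \<Longrightarrow> \<alpha> \<le> 1 \<Longrightarrow> gen_geod \<Omega> \<alpha> \<in> dom_E w E"
      and le: "\<And>\<alpha>. 0 \<le> \<alpha> \<Longrightarrow> \<alpha> \<le> 1 \<Longrightarrow>
        e (gen_geod \<Omega> \<alpha>) \<le> (1 - \<alpha>) * e \<mu> + \<alpha> * e v - \<alpha> * (1 - \<alpha>) * (lam / 2) * (W2_plan \<Omega>)\<^sup>2"
      using convex_plan[OF dom_P2[OF dom\<mu>] dom\<mu> v] by metis
    note plan = \<Omega> dom_P2[OF dom\<mu>] dom_P2[OF dom\<mu>] dom_P2[OF v]
    \<comment> \<open>The base equals the starting point, so the upper and lower bounds on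
      \<open>W2_plan\<close> coincide, and the geodesic leaves \<open>\<mu>\<close> at constant
      speed.\<close>
    have R: "W2_plan \<Omega> = W"
      using W2_plan_le[OF plan] W2_le_W2_plan[OF plan] by (simp add: W2_self[OF plan(2)] W_def)
    define q where "q \<alpha> = (e \<mu> - e v + (1 - \<alpha>) * (lam / 2) * W\<^sup>2) / W" for \<alpha>
    have quot: "W2 \<mu> (gen_geod \<Omega> \<alpha>) = \<alpha> * W"
      "ereal (q \<alpha>) \<le> max 0 ((E \<mu> - E (gen_geod \<Omega> \<alpha>)) / ereal (W2 \<mu> (gen_geod \<Omega> \<alpha>)))"
      if \<alpha>: "0 < \<alpha>" "\<alpha> < 1" for \<alpha>
    proof -
      have dom\<alpha>: "gen_geod \<Omega> \<alpha> \<in> dom_E w E" using \<alpha> by (intro dom) auto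
      have "W2 \<mu> (gen_geod \<Omega> \<alpha>) \<le> \<alpha> * W" "W2 (gen_geod \<Omega> \<alpha>) v \<le> (1 - \<alpha>) * W"
        using W2_start_gen_geod_le[OF plan, of \<alpha>] W2_gen_geod_end_le[OF plan, of \<alpha>] \<alpha> by (auto simp: R)
      moreover have "W \<le> W2 \<mu> (gen_geod \<Omega> \<alpha>) + W2 (gen_geod \<Omega> \<alpha>) v"
        unfolding W_def using dom\<mu> dom\<alpha> v by (intro P2_triangle[of _ w] dom_P2)
      ultimately show eq: "W2 \<mu> (gen_geod \<Omega> \<alpha>) = \<alpha> * W" by (simp add: algebra_simps)
      have "\<alpha> * (e \<mu> - e v + (1 - \<alpha>) * (lam / 2) * W\<^sup>2) \<le> e \<mu> - e (gen_geod \<Omega> \<alpha>)"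
        using le[of \<alpha>] \<alpha> by (simp add: R algebra_simps)
      then have "\<alpha> * (e \<mu> - e v + (1 - \<alpha>) * (lam / 2) * W\<^sup>2) / (\<alpha> * W) \<le> (e \<mu> - e (gen_geod \<Omega> \<alpha>)) / (\<alpha> * W)"
        using \<alpha> W by (intro divide_right_mono) auto
      then have "q \<alpha> \<le> (e \<mu> - e (gen_geod \<Omega> \<alpha>)) / (\<alpha> * W)"
        using \<alpha> by (simp add: q_def)
      then show "ereal (q \<alpha>) \<le> max 0 ((E \<mu> - E (gen_geod \<Omega> \<alpha>)) / ereal (W2 \<mu> (gen_geod \<Omega> \<alpha>)))"
        using \<alpha> W by (simp add: dom_eq dom\<mu> dom\<alpha> eq le_max_iff_disj)
    qed
    have ge: "ereal (max 0 (q 0)) \<le> slope w E \<mu>"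
      unfolding slope_def
    proof (rule INF_greatest)
      fix \<delta> :: real assume "\<delta> \<in> {0<..}"
      then have \<delta>: "\<delta> > 0" by simp
      let ?f = "\<lambda>\<nu>. max 0 ((E \<mu> - E \<nu>) / ereal (W2 \<mu> \<nu>))"
      let ?B = "{\<nu> \<in> P2 w. 0 < W2 \<mu> \<nu> \<and> W2 \<mu> \<nu> < \<delta>}"
      show "ereal (max 0 (q 0)) \<le> (SUP \<nu>\<in>?B. ?f \<nu>)"
      \<comment> \<open>For \<alpha> below 1 and \<open>\<delta> / W\<close> the geodesic points lie
        in the punctured ball \<open>?B\<close>, so the supremum dominates each
        \<open>q \<alpha>\<close>.\<close>
      proof (rule tendsto_upperbound)
        show "((\<lambda>\<alpha>. ereal (max 0 (q \<alpha>))) \<longlongrightarrow> ereal (max 0 (q 0))) (at_right 0)"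
          unfolding q_def using W by (intro tendsto_intros) auto
        have "\<forall>\<^sub>F \<alpha> in at_right 0. \<alpha> \<in> {0<..<min 1 (\<delta> / W)}"
          using \<delta> W by (intro eventually_at_right_real) auto
        then show "\<forall>\<^sub>F \<alpha> in at_right 0. ereal (max 0 (q \<alpha>)) \<le> (SUP \<nu>\<in>?B. ?f \<nu>)"
        proof eventually_elim
          case (elim \<alpha>)
          then have \<alpha>: "0 < \<alpha>" "\<alpha> < 1" "\<alpha> * W < \<delta>" using W by (auto simp: field_simps)
          have "ereal (max 0 (q \<alpha>)) = max 0 (ereal (q \<alpha>))"
            by (simp add: max_def zero_ereal_def)
          also have "\<dots> \<le> ?f (gen_geod \<Omega> \<alpha>)"
            using quot(2)[OF \<alpha>(1,2)] by simp
          also have "\<dots> \<le> (SUP \<nu>\<in>?B. ?f \<nu>)"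
            using \<alpha> W by (intro SUP_upper) (auto simp: quot(1) intro!: dom_P2 dom)
          finally show ?case .
        qed
      qed simp
    qed
    \<comment> \<open>The slope is finite and, by \<open>ge\<close>, nonnegative, so
      \<open>real_of_ereal\<close> loses nothing.\<close>
    have "q 0 \<le> real_of_ereal (slope w E \<mu>)"
      using ge fin by (cases "slope w E \<mu>") (auto simp: max_def split: if_splits)
    then have "q 0 * W \<le> real_of_ereal (slope w E \<mu>) * W"
      using W by (intro mult_right_mono) auto
    then show ?thesis using W unfolding W_def[symmetric] by (simp add: q_def)
  qed
qed

end

text \<open>In both lemmas \<open>T\<close> is \<open>1 + lam * \<tau>\<close>, and the hypotheses \<open>A\<close>, \<open>B\<close> are the discrete
  variational inequalities of \<open>\<mu>\<close> tested with \<open>J \<nu>\<close> and of \<open>\<nu>\<close> tested with \<open>\<mu>\<close>.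
  For \<open>lam > 0\<close> one eliminates \<open>b = W2 \<mu> (J \<nu>)\<close> by adding \<open>T * A\<close> and \<open>B\<close>; for
  \<open>lam \<le> 0\<close> one adds \<open>T * A\<close> and \<open>T * B\<close> and bounds \<open>b\<close> by the triangle inequality through \<open>\<nu>\<close>.\<close>

lemma almost_contraction_pos:
  fixes a b c D f s \<tau> lam :: real
  defines "T \<equiv> 1 + lam * \<tau>"
  assumes A: "T * c\<^sup>2 \<le> b\<^sup>2 + 2 * \<tau> * (E1 - E0) - a\<^sup>2"
    and B: "T * b\<^sup>2 \<le> D\<^sup>2 + 2 * \<tau> * (E2 - E1) - f\<^sup>2"
    and S: "E2 - E0 \<le> s * a - lam / 2 * a\<^sup>2"
    and \<tau>: "\<tau> > 0" and lam: "lam > 0"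
  shows "T\<^sup>2 * c\<^sup>2 \<le> D\<^sup>2 + \<tau>\<^sup>2 * s\<^sup>2 + 2 * lam * \<tau>\<^sup>2 * (E1 - E0)"
proof -
  have T: "T > 0" using \<tau> lam by (simp add: T_def add_pos_pos)
  have "T * (T * c\<^sup>2) \<le> T * (b\<^sup>2 + 2 * \<tau> * (E1 - E0) - a\<^sup>2)"
    using T A by (intro mult_left_mono) auto
  \<comment> \<open>Expanding the factor \<open>T\<close> on the energy difference produces the
    extra energy term of the claim.\<close>
  also have "\<dots> = T * b\<^sup>2 + 2 * \<tau> * (E1 - E0) + 2 * lam * \<tau>\<^sup>2 * (E1 - E0) - T * a\<^sup>2"
    by (simp add: T_def algebra_simps power2_eq_square)
  also have "\<dots> \<le> D\<^sup>2 + 2 * \<tau> * (E2 - E0) + 2 * lam * \<tau>\<^sup>2 * (E1 - E0) - T * a\<^sup>2"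
    using B zero_le_power2[of f] unfolding right_diff_distrib by linarith
  finally have 1: "T\<^sup>2 * c\<^sup>2 \<le> D\<^sup>2 + 2 * \<tau> * (E2 - E0) + 2 * lam * \<tau>\<^sup>2 * (E1 - E0) - T * a\<^sup>2"
    by (simp add: power2_eq_square)
  \<comment> \<open>Completing the square trades the mixed term \<open>s * a\<close> for the slope
    term; the leftover is absorbed by the \<open>T * a\<^sup>2\<close> in \<open>1\<close>.\<close>
  have "2 * \<tau> * (E2 - E0) \<le> 2 * \<tau> * (s * a - lam / 2 * a\<^sup>2)"
    using \<tau> S by (intro mult_left_mono) auto
  also have "\<dots> = \<tau>\<^sup>2 * s\<^sup>2 + a\<^sup>2 - (\<tau> * s - a)\<^sup>2 - lam * \<tau> * a\<^sup>2"
    by (simp add: algebra_simps power2_eq_square)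
  also have "\<dots> \<le> \<tau>\<^sup>2 * s\<^sup>2 + T * a\<^sup>2"
  proof -
    have "0 \<le> lam * \<tau> * a\<^sup>2" using \<tau> lam by simp
    moreover have "T * a\<^sup>2 = a\<^sup>2 + lam * \<tau> * a\<^sup>2" by (simp add: T_def distrib_right)
    ultimately show ?thesis using zero_le_power2[of "\<tau> * s - a"] by linarith
  qed
  finally show ?thesis using 1 by linarith
qed

lemma almost_contraction_nonpos:
  fixes a b c D f s \<tau> lam :: real
  defines "T \<equiv> 1 + lam * \<tau>"
  assumes A: "T * c\<^sup>2 \<le> b\<^sup>2 + 2 * \<tau> * (E1 - E0) - a\<^sup>2"
    and B: "T * b\<^sup>2 \<le> D\<^sup>2 + 2 * \<tau> * (E2 - E1) - f\<^sup>2"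
    and S: "E2 - E0 \<le> s * a - lam / 2 * a\<^sup>2"
    and b: "0 \<le> b" "b \<le> D + f" and \<tau>: "\<tau> > 0" and T: "T > 0" and lam: "lam \<le> 0"
  shows "T\<^sup>2 * c\<^sup>2 \<le> D\<^sup>2 + \<tau>\<^sup>2 * s\<^sup>2"
proof -
  \<comment> \<open>\<open>k\<close> equals \<open>- lam * \<tau>\<close>, the weight complementary
    to \<open>T\<close>.\<close>
  define k where "k = 1 - T"
  have k: "k \<ge> 0" using \<tau> lam by (simp add: k_def T_def mult_nonpos_nonneg)
  have "T * (T * c\<^sup>2 + T * b\<^sup>2) \<le> T * (b\<^sup>2 + D\<^sup>2 + 2 * \<tau> * (E2 - E0) - a\<^sup>2 - f\<^sup>2)"
    using T A B by (intro mult_left_mono) (auto simp: algebra_simps)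
  then have 1: "T\<^sup>2 * c\<^sup>2 \<le> T * k * b\<^sup>2 + T * D\<^sup>2 + T * (2 * \<tau> * (E2 - E0) - a\<^sup>2) - T * f\<^sup>2"
    by (simp add: k_def algebra_simps power2_eq_square)
  have "2 * \<tau> * (E2 - E0) \<le> 2 * \<tau> * (s * a - lam / 2 * a\<^sup>2)"
    using \<tau> S by (intro mult_left_mono) auto
  \<comment> \<open>The term with \<open>lam\<close> turns the coefficient of
    \<open>a\<^sup>2\<close> from 1 into \<open>T\<close>; after the outer factor \<open>T\<close> a
    perfect square splits off.\<close>
  then have "T * (2 * \<tau> * (E2 - E0) - a\<^sup>2) \<le> T * (2 * \<tau> * s * a - T * a\<^sup>2)"
    using T by (intro mult_left_mono) (auto simp: T_def algebra_simps)
  also have "\<dots> = \<tau>\<^sup>2 * s\<^sup>2 - (\<tau> * s - T * a)\<^sup>2"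
    by (simp add: algebra_simps power2_eq_square)
  also have "\<dots> \<le> \<tau>\<^sup>2 * s\<^sup>2" by simp
  finally have 2: "T * (2 * \<tau> * (E2 - E0) - a\<^sup>2) \<le> \<tau>\<^sup>2 * s\<^sup>2" .
  have "T * k * b\<^sup>2 \<le> T * k * (D + f)\<^sup>2"
    using T k b by (intro mult_left_mono power_mono) auto
  \<comment> \<open>Because \<open>k + T = 1\<close>, the triangle bound on \<open>b\<close> costs
    at most \<open>k * D\<^sup>2\<close> plus the \<open>T * f\<^sup>2\<close> that \<open>B\<close>
    supplies.\<close>
  also have "\<dots> = k * D\<^sup>2 + T * f\<^sup>2 - (k * D - T * f)\<^sup>2"
    by (simp add: k_def algebra_simps power2_eq_square)
  also have "\<dots> \<le> k * D\<^sup>2 + T * f\<^sup>2" by simp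
  finally have 3: "T * k * b\<^sup>2 \<le> k * D\<^sup>2 + T * f\<^sup>2" .
  have "k * D\<^sup>2 + T * D\<^sup>2 = D\<^sup>2" by (simp add: k_def algebra_simps)
  with 1 2 3 show ?thesis by linarith
qed

section \<open>Combination of the inequalities\<close>

theorem theorem2p1:
  fixes \<omega>0 :: "'a::euclidean_space measure"
    and E :: "'a measure \<Rightarrow> ereal"
    and lam \<tau> :: real
    and \<mu> \<nu> :: "'a measure"
  assumes "\<omega>0 \<in> pmeas"
    and "\<forall>\<rho>\<in>P2 \<omega>0. E \<rho> \<noteq> -\<infinity>"
    and "proper \<omega>0 E" and "coercive \<omega>0 E" and "W2_lsc \<omega>0 E" and "gg_convex \<omega>0 E lam"
    and "\<mu> \<in> dom_slope \<omega>0 E" and "\<nu> \<in> cl_dom_E \<omega>0 E"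
    and "0 < \<tau>" and "ereal \<tau> < lam_minus_inv_bound lam"
  shows "(lam > 0 \<longrightarrow>
           ereal ((1 + lam * \<tau>)\<^sup>2 * (W2 (prox \<omega>0 E \<tau> \<mu>) (prox \<omega>0 E \<tau> \<nu>))\<^sup>2)
             \<le> ereal ((W2 \<mu> \<nu>)\<^sup>2 + \<tau>\<^sup>2 * (real_of_ereal (slope \<omega>0 E \<mu>))\<^sup>2)
                + ereal (2 * lam * \<tau>\<^sup>2) * (E \<nu> - (INF \<rho>\<in>P2 \<omega>0. E \<rho>)))
       \<and> (lam \<le> 0 \<longrightarrow>
           (1 + lam * \<tau>)\<^sup>2 * (W2 (prox \<omega>0 E \<tau> \<mu>) (prox \<omega>0 E \<tau> \<nu>))\<^sup>2
             \<le> (W2 \<mu> \<nu>)\<^sup>2 + \<tau>\<^sup>2 * (real_of_ereal (slope \<omega>0 E \<mu>))\<^sup>2)"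
proof -
  interpret gg_functional \<omega>0 E lam
    using assms by unfold_locales auto
  have \<mu>: "\<mu> \<in> dom_E \<omega>0 E" and \<nu>: "\<nu> \<in> P2 \<omega>0"
    using assms by (auto simp: dom_slope_def cl_dom_E_def)
  note \<tau> = \<open>0 < \<tau>\<close>
  have T: "1 + lam * \<tau> > 0"
  proof (cases "lam \<ge> 0")
    case True
    then show ?thesis using \<tau> by (simp add: add_pos_nonneg)
  next
    case False
    then have "\<tau> < 1 / (- lam)" using assms(10) by (simp add: lam_minus_inv_bound_def)
    then show ?thesis using False by (simp add: field_simps)
  qed
  then have m: "1 / \<tau> + lam > 0" using \<tau> by (simp add: field_simps)
  define J\<mu> where "J\<mu> = prox \<omega>0 E \<tau> \<mu>"
  define J\<nu> where "J\<nu> = prox \<omega>0 E \<tau> \<nu>"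
  have J: "J\<mu> \<in> dom_E \<omega>0 E" "J\<nu> \<in> dom_E \<omega>0 E"
    unfolding J\<mu>_def J\<nu>_def by (rule prox_dom[OF dom_P2[OF \<mu>] \<tau> m] prox_dom[OF \<nu> \<tau> m])+
  have A: "(1 + lam * \<tau>) * (W2 J\<mu> J\<nu>)\<^sup>2 \<le> (W2 \<mu> J\<nu>)\<^sup>2 + 2 * \<tau> * (e J\<nu> - e J\<mu>) - (W2 \<mu> J\<mu>)\<^sup>2"
    unfolding J\<mu>_def by (rule discrete_variational_inequality[OF dom_P2[OF \<mu>] \<tau> m J(2)])
  have B: "(1 + lam * \<tau>) * (W2 \<mu> J\<nu>)\<^sup>2 \<le> (W2 \<mu> \<nu>)\<^sup>2 + 2 * \<tau> * (e \<mu> - e J\<nu>) - (W2 \<nu> J\<nu>)\<^sup>2"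
    using discrete_variational_inequality[OF \<nu> \<tau> m \<mu>] by (simp add: J\<nu>_def W2_commute)
  have S: "e \<mu> - e J\<mu> \<le> real_of_ereal (slope \<omega>0 E \<mu>) * W2 \<mu> J\<mu> - lam / 2 * (W2 \<mu> J\<mu>)\<^sup>2"
    by (rule slope_inequality[OF assms(7) J(1)])
  show ?thesis
    unfolding J\<mu>_def[symmetric] J\<nu>_def[symmetric]
  proof (intro conjI impI)
    assume "lam \<le> 0"
    then show "(1 + lam * \<tau>)\<^sup>2 * (W2 J\<mu> J\<nu>)\<^sup>2 \<le> (W2 \<mu> \<nu>)\<^sup>2 + \<tau>\<^sup>2 * (real_of_ereal (slope \<omega>0 E \<mu>))\<^sup>2"
      by (intro almost_contraction_nonpos[OF A B S _ P2_triangle[OF dom_P2[OF \<mu>] \<nu> dom_P2[OF J(2)]] \<tau> T]) auto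
  next
    assume lam: "lam > 0"
    let ?I = "INF \<rho>\<in>P2 \<omega>0. E \<rho>"
    have I: "?I \<le> E J\<mu>" using dom_P2[OF J(1)] by (rule INF_lower)
    note le = almost_contraction_pos[OF A B S \<tau> lam]
    show "ereal ((1 + lam * \<tau>)\<^sup>2 * (W2 J\<mu> J\<nu>)\<^sup>2)
        \<le> ereal ((W2 \<mu> \<nu>)\<^sup>2 + \<tau>\<^sup>2 * (real_of_ereal (slope \<omega>0 E \<mu>))\<^sup>2)
          + ereal (2 * lam * \<tau>\<^sup>2) * (E \<nu> - ?I)"
    \<comment> \<open>If \<open>\<nu>\<close> has infinite energy or the infimum is -\<infinity>,
      the right side is \<infinity> because its coefficient is positive.\<close>
    proof (cases "E \<nu> = \<infinity> \<or> ?I = -\<infinity>")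
      case True
      have "?I \<noteq> \<infinity>" using I by (auto simp: dom_eq[OF J(1)])
      then have "E \<nu> - ?I = \<infinity>" using True not_MInf[OF \<nu>] by (cases "E \<nu>"; cases ?I) auto
      then show ?thesis using lam \<tau> by simp
    next
      case False
      then obtain i where i: "?I = ereal i" using I by (cases ?I) (auto simp: dom_eq[OF J(1)])
      have dom\<nu>: "\<nu> \<in> dom_E \<omega>0 E" using False \<nu> by (simp add: dom_E_def)
      \<comment> \<open>Minimality of \<open>J\<nu>\<close> is tested with \<open>\<nu>\<close>
        itself; together with \<open>I\<close> this bounds the energy drop between the proximal
        points by \<open>e \<nu> - i\<close>.\<close>
      have "e J\<nu> \<le> e \<nu>"
        using prox_minimal[OF \<nu> \<tau> m dom\<nu>] \<tau> zero_le_power2[of "W2 \<nu> J\<nu>"]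
        unfolding J\<nu>_def[symmetric] prox_objective_def W2_self[OF \<nu>]
        by (smt (verit) divide_nonneg_pos power_zero_numeral div_0)
      moreover have "i \<le> e J\<mu>" using I by (simp add: i dom_eq[OF J(1)])
      ultimately have "2 * lam * \<tau>\<^sup>2 * (e J\<nu> - e J\<mu>) \<le> 2 * lam * \<tau>\<^sup>2 * (e \<nu> - i)"
        using lam by (intro mult_left_mono) auto
      then show ?thesis using le by (simp add: i dom_eq[OF dom\<nu>])
    qed
  qed
qed

end
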